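(* Let $z=f(x,y)$ be a real analytic solution to the minimal surface equation $$(1+f_y^2)f_{xx}-2f_xf_yf_{xy}+(1+f_x^2)f_{yy}=0$$ whose graph in Euclidean space $\mathbb{E}^3(x,y,z)$ has no umbilic points on $y=0$. The following statements hold. (i) If $f$ is even with respect to the $y$-axis, i.e. $f(x,-y)=f(x,y)$, then the graph $\tilde y=h(\tilde t,\tilde x):=f(\tilde x,i\tilde t)$ in $\mathbb{L}^3(\tilde t,\tilde x,\tilde y)$ is, near $\tilde t=y=0$, a timelike solution with negative Gaussian curvature to the Born-Infeld equation $$(1-h_{\tilde t}^2)h_{\tilde x\tilde x}+2h_{\tilde t}h_{\tilde x}h_{\tilde t\tilde x}-(1+h_{\tilde x}^2)h_{\tilde t\tilde t}=0,$$ where $\tilde t=y$, $\tilde x=x$ and $\tilde y=z$. (ii) If $f$ is odd with respect to the $y$-axis, i.e. $f(x,-y)=-f(x,y)$, then the graph $\tilde y=h(\tilde t,\tilde x):=-if(\tilde t,i\tilde x)$ in $\mathbb{L}^3(\tilde t,\tilde x,\tilde y)$ is, near $\tilde x=y=0$, a timelike solution with positive Gaussian curvature to the same Born-Infeld equation, where $\tilde t=x$, $\tilde x=y$ and $\tilde y=z$.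
   Context: Wick rotations: functions are real analytic on a (connected) domain that meets the line $\{y=0\}$ and is symmetric under $y\mapsto -y$. For real $s$ near $0$, $f(x,is)$ denotes the value obtained by substituting $is$ for $y$ in the Taylor expansion $f(x,y)=\sum_n a_n(x)y^n$ (analytic continuation). The rotated graphs are considered near the line where the rotated variable vanishes. $\mathbb{L}^3(t,x,y)$ is Lorentz-Minkowski 3-space with metric $-(dt)^2+(dx)^2+(dy)^2$. A surface is spacelike (resp. timelike, lightlike) at a point if its induced metric (first fundamental form) is Riemannian (resp. Lorentzian, degenerate) there. For a spacelike or timelike surface in $\mathbb{L}^3$ with unit normal $\nu$ and shape operator $S$, set $\varepsilon=\langle\nu,\nu\rangle$ ($\varepsilon=1$ if timelike, $-1$ if spacelike); the Gaussian curvature is $K=\varepsilon\det S$. For a graph $y=h(t,x)$ this equals $$K_h=-\frac{h_{tt}h_{xx}-h_{tx}^2}{(1-h_t^2+h_x^2)^2}.$$ *)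

theory Defs
  imports "HOL-Analysis.Analysis"
begin

section \<open>Functions of two real variables\<close>

definition partial1 :: "(real \<Rightarrow> real \<Rightarrow> 'a::real_normed_vector) \<Rightarrow> real \<Rightarrow> real \<Rightarrow> 'a" where
  "partial1 F u v = vector_derivative (\<lambda>s. F s v) (at u)"

definition partial2 :: "(real \<Rightarrow> real \<Rightarrow> 'a::real_normed_vector) \<Rightarrow> real \<Rightarrow> real \<Rightarrow> 'a" where
  "partial2 F u v = vector_derivative (\<lambda>s. F u s) (at v)"

definition real_analytic_on :: "(real \<Rightarrow> real \<Rightarrow> real) \<Rightarrow> (real \<times> real) set \<Rightarrow> bool" where
  "real_analytic_on f D \<longleftrightarrow>
     (\<forall>(a, b)\<in>D. \<exists>c :: nat \<Rightarrow> nat \<Rightarrow> real. \<forall>\<^sub>F (x, y) in nhds (a, b).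
        ((\<lambda>(m, n). c m n * (x - a) ^ m * (y - b) ^ n) has_sum f x y) UNIV)"

text \<open>The Taylor expansion of \<open>f (x, y)\<close> in powers of \<open>y\<close> about \<open>y = 0\<close>, with a complex
  number \<open>z\<close> substituted for \<open>y\<close>.\<close>

definition taylor_term :: "(real \<Rightarrow> real \<Rightarrow> real) \<Rightarrow> real \<Rightarrow> complex \<Rightarrow> nat \<Rightarrow> complex" where
  "taylor_term f x z n = complex_of_real ((partial2 ^^ n) f x 0 / fact n) * z ^ n"

definition taylor_subst :: "(real \<Rightarrow> real \<Rightarrow> real) \<Rightarrow> real \<Rightarrow> complex \<Rightarrow> complex" where
  "taylor_subst f x z = (\<Sum>n. taylor_term f x z n)"

definition minimal_surface_eq :: "(real \<Rightarrow> real \<Rightarrow> real) \<Rightarrow> real \<Rightarrow> real \<Rightarrow> bool" where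
  "minimal_surface_eq f x y \<longleftrightarrow>
     (1 + (partial2 f x y)\<^sup>2) * partial1 (partial1 f) x y
     - 2 * partial1 f x y * partial2 f x y * partial2 (partial1 f) x y
     + (1 + (partial1 f x y)\<^sup>2) * partial2 (partial2 f) x y = 0"

definition born_infeld_eq :: "(real \<Rightarrow> real \<Rightarrow> real) \<Rightarrow> real \<Rightarrow> real \<Rightarrow> bool" where
  "born_infeld_eq h t x \<longleftrightarrow>
     (1 - (partial1 h t x)\<^sup>2) * partial2 (partial2 h) t x
     + 2 * partial1 h t x * partial2 h t x * partial2 (partial1 h) t x
     - (1 + (partial2 h t x)\<^sup>2) * partial1 (partial1 h) t x = 0"


section \<open>Surfaces in three-dimensional Euclidean and Lorentz-Minkowski space\<close>

text \<open>The ambient scalar product \<open>g\<close> is a parameter: \<open>inner\<close> for Euclidean space,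
  \<open>lorentz\<close> for Lorentz-Minkowski space with coordinates \<open>(t, x, y)\<close>.\<close>

definition lorentz :: "real^3 \<Rightarrow> real^3 \<Rightarrow> real" where
  "lorentz v w = - (v $ 1 * w $ 1) + v $ 2 * w $ 2 + v $ 3 * w $ 3"

definition graph_surface :: "(real \<Rightarrow> real \<Rightarrow> real) \<Rightarrow> real \<Rightarrow> real \<Rightarrow> real^3" where
  "graph_surface f u v = vector [u, v, f u v]"

text \<open>Tangent vectors of a parametrised surface are represented by their coordinates in the
  frame of the two partial derivatives; \<open>surf_differential F u v\<close> is the differential of
  \<open>F\<close> at \<open>(u, v)\<close>.\<close>

definition surf_differential ::
    "(real \<Rightarrow> real \<Rightarrow> real^3) \<Rightarrow> real \<Rightarrow> real \<Rightarrow> real^2 \<Rightarrow> real^3" where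
  "surf_differential F u v a = (a $ 1) *\<^sub>R partial1 F u v + (a $ 2) *\<^sub>R partial2 F u v"

definition first_form ::
    "(real^3 \<Rightarrow> real^3 \<Rightarrow> real) \<Rightarrow> (real \<Rightarrow> real \<Rightarrow> real^3) \<Rightarrow> real \<Rightarrow> real \<Rightarrow> real^2 \<Rightarrow> real^2 \<Rightarrow> real" where
  "first_form g X u v a b = g (surf_differential X u v a) (surf_differential X u v b)"

text \<open>A symmetric bilinear form on the plane is Lorentzian if it has signature \<open>(-, +)\<close>;
  the two vectors below are automatically a basis.\<close>

definition lorentzian_form :: "(real^2 \<Rightarrow> real^2 \<Rightarrow> real) \<Rightarrow> bool" where
  "lorentzian_form B \<longleftrightarrow> (\<exists>a b. B a a = -1 \<and> B b b = 1 \<and> B a b = 0)"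

definition timelike_at :: "(real \<Rightarrow> real \<Rightarrow> real^3) \<Rightarrow> real \<Rightarrow> real \<Rightarrow> bool" where
  "timelike_at X u v \<longleftrightarrow> lorentzian_form (first_form lorentz X u v)"

definition unit_normal_on ::
    "(real^3 \<Rightarrow> real^3 \<Rightarrow> real) \<Rightarrow> (real \<Rightarrow> real \<Rightarrow> real^3) \<Rightarrow> (real \<times> real) set \<Rightarrow>
     (real \<Rightarrow> real \<Rightarrow> real^3) \<Rightarrow> bool" where
  "unit_normal_on g X U \<nu> \<longleftrightarrow>
     (\<lambda>(u, v). \<nu> u v) differentiable_on U \<and>
     (\<forall>(u, v)\<in>U. \<bar>g (\<nu> u v) (\<nu> u v)\<bar> = 1 \<and> (\<forall>a. g (\<nu> u v) (surf_differential X u v a) = 0))"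

text \<open>\<open>S\<close> is the matrix, in the coordinate frame, of the shape operator at \<open>(u, v)\<close> with
  respect to the unit normal field \<open>\<nu>\<close> defined near \<open>(u, v)\<close>.\<close>

definition has_shape_operator ::
    "(real^3 \<Rightarrow> real^3 \<Rightarrow> real) \<Rightarrow> (real \<Rightarrow> real \<Rightarrow> real^3) \<Rightarrow> real \<Rightarrow> real \<Rightarrow>
     (real \<Rightarrow> real \<Rightarrow> real^3) \<Rightarrow> real^2^2 \<Rightarrow> bool" where
  "has_shape_operator g X u v \<nu> S \<longleftrightarrow>
     (\<exists>U. open U \<and> (u, v) \<in> U \<and> unit_normal_on g X U \<nu>) \<and>
     (\<forall>a. surf_differential \<nu> u v a = - surf_differential X u v (S *v a))"

text \<open>The unit normal is unique up to sign, so the next two notions do not depend on its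
  choice.\<close>

definition umbilic_at ::
    "(real^3 \<Rightarrow> real^3 \<Rightarrow> real) \<Rightarrow> (real \<Rightarrow> real \<Rightarrow> real^3) \<Rightarrow> real \<Rightarrow> real \<Rightarrow> bool" where
  "umbilic_at g X u v \<longleftrightarrow> (\<exists>\<nu> k. has_shape_operator g X u v \<nu> (k *\<^sub>R mat 1))"

definition has_gauss_curvature ::
    "(real^3 \<Rightarrow> real^3 \<Rightarrow> real) \<Rightarrow> (real \<Rightarrow> real \<Rightarrow> real^3) \<Rightarrow> real \<Rightarrow> real \<Rightarrow> real \<Rightarrow> bool" where
  "has_gauss_curvature g X u v K \<longleftrightarrow>
     (\<exists>\<nu> S. has_shape_operator g X u v \<nu> S \<and> K = g (\<nu> u v) (\<nu> u v) * det S)"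

end

theory Submission
  imports Defs "HOL-Complex_Analysis.Conformal_Mappings"
begin

text \<open>
  Near a point \<open>(a, 0)\<close> the function \<open>f\<close> is the sum of an absolutely convergent double power series in
  \<open>x - a\<close> and \<open>y\<close>. Substituting \<open>\<i> * y\<close> for \<open>y\<close> multiplies the coefficient of \<open>y ^ n\<close> by \<open>\<i> ^ n\<close>. If
  \<open>f\<close> is even in \<open>y\<close> only even \<open>n\<close> occur and the result is again a real power series; if \<open>f\<close> is odd it
  becomes one after multiplication by \<open>- \<i>\<close>. So the rotated function is real analytic
  (\<open>wick_rotation_expansion\<close>, \<open>expands_as_real_analytic\<close>).

  The minimal surface equation holds for real \<open>y\<close>. For fixed \<open>x\<close> its left-hand side extends
  holomorphically to complex \<open>y\<close>, hence it holds at \<open>\<i> * y\<close> as well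
  (\<open>minimal_surface_eq_complexified\<close>). Rewriting the derivatives of \<open>f\<close> there as derivatives of the
  rotated function gives the Born-Infeld equation (\<open>wick_rotation_pde\<close>).

  For a graph over the \<open>(t, x)\<close>-plane with \<open>1 - h\<^sub>t\<^sup>2 + h\<^sub>x\<^sup>2 > 0\<close> the surface is timelike, and its
  curvature is minus the Hessian determinant divided by the square of that quantity
  (\<open>timelike_at_graph\<close>, \<open>graph_has_gauss_curvature\<close>). On the axis the parity of \<open>f\<close> makes several
  derivatives vanish. In the even case the minimal surface equation expresses \<open>f\<^sub>x\<^sub>x\<close> through \<open>f\<^sub>y\<^sub>y\<close>, in
  the odd case only \<open>f\<^sub>x\<^sub>y\<close> is left; since the axis carries no umbilics, the Hessian determinant of the
  rotated function is nonzero and its sign is known. By continuity the same holds near the axis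
  (\<open>wick_rotation_even\<close>, \<open>wick_rotation_odd\<close>).\<close>

section \<open>Double power series\<close>

definition double_series ::
    "(nat \<Rightarrow> nat \<Rightarrow> 'a) \<Rightarrow> 'a \<Rightarrow> 'a \<Rightarrow> 'a::{real_normed_field, banach}" where
  "double_series c u v = (\<Sum>\<^sub>\<infinity>(m, n). c m n * u ^ m * v ^ n)"

text \<open>Asking for absolute convergence only on polydiscs of radius strictly below \<open>R\<close> makes the
  notion stable under termwise differentiation with the same \<open>R\<close>.\<close>

definition converges_within ::
    "(nat \<Rightarrow> nat \<Rightarrow> 'a::real_normed_field) \<Rightarrow> real \<Rightarrow> bool" where
  "converges_within c R \<longleftrightarrow>
     (\<forall>\<rho>. 0 \<le> \<rho> \<and> \<rho> < R \<longrightarrow> (\<lambda>(m, n). norm (c m n) * \<rho> ^ (m + n)) summable_on UNIV)"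

definition transpose_coeff :: "(nat \<Rightarrow> nat \<Rightarrow> 'a) \<Rightarrow> nat \<Rightarrow> nat \<Rightarrow> 'a" where
  "transpose_coeff c m n = c n m"

definition diff_coeff1 :: "(nat \<Rightarrow> nat \<Rightarrow> 'a::semiring_1) \<Rightarrow> nat \<Rightarrow> nat \<Rightarrow> 'a" where
  "diff_coeff1 c m n = of_nat (Suc m) * c (Suc m) n"

definition diff_coeff2 :: "(nat \<Rightarrow> nat \<Rightarrow> 'a::semiring_1) \<Rightarrow> nat \<Rightarrow> nat \<Rightarrow> 'a" where
  "diff_coeff2 c m n = of_nat (Suc n) * c m (Suc n)"

lemma abs_summable_double_series:
  fixes c :: "nat \<Rightarrow> nat \<Rightarrow> 'a::real_normed_field"
  assumes "converges_within c R" "norm u < R" "norm v < R"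
  shows "(\<lambda>p. norm (case p of (m, n) \<Rightarrow> c m n * u ^ m * v ^ n)) summable_on UNIV"
proof -
  define \<rho> where "\<rho> = max (norm u) (norm v)"
  have \<rho>: "0 \<le> \<rho>" "\<rho> < R" "norm u \<le> \<rho>" "norm v \<le> \<rho>"
    using assms by (auto simp: \<rho>_def le_max_iff_disj)
  have "(\<lambda>(m, n). norm (c m n) * \<rho> ^ (m + n)) summable_on UNIV"
    using assms(1) \<rho> by (auto simp: converges_within_def)
  then show ?thesis
  proof (rule Infinite_Sum.abs_summable_on_comparison_test')
    fix p :: "nat \<times> nat"
    obtain m n where p: "p = (m, n)" by fastforce
    have "norm u ^ m * norm v ^ n \<le> \<rho> ^ m * \<rho> ^ n"
      using \<rho> by (intro mult_mono power_mono) auto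
    then show "norm (case p of (m, n) \<Rightarrow> c m n * u ^ m * v ^ n)
        \<le> (case p of (m, n) \<Rightarrow> norm (c m n) * \<rho> ^ (m + n))"
      by (simp add: p norm_mult norm_power power_add mult.assoc mult_left_mono)
  qed
qed

lemma has_sum_double_series:
  fixes c :: "nat \<Rightarrow> nat \<Rightarrow> 'a::{real_normed_field, banach}"
  assumes "converges_within c R" "norm u < R" "norm v < R"
  shows "((\<lambda>(m, n). c m n * u ^ m * v ^ n) has_sum double_series c u v) UNIV"
  using abs_summable_summable[OF abs_summable_double_series[OF assms]]
  by (simp add: double_series_def case_prod_unfold)

lemma converges_withinI_summable:
  fixes c :: "nat \<Rightarrow> nat \<Rightarrow> 'a::real_normed_field"
  assumes "(\<lambda>p. norm (case p of (m, n) \<Rightarrow> c m n * u ^ m * v ^ n)) summable_on UNIV" "R \<le> norm u" "R \<le> norm v"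
  shows "converges_within c R"
  unfolding converges_within_def
proof (intro allI impI, elim conjE)
  fix \<rho> assume \<rho>: "0 \<le> \<rho>" "\<rho> < R"
  have "(\<lambda>p. norm (case p of (m, n) \<Rightarrow> norm (c m n) * \<rho> ^ (m + n))) summable_on UNIV"
  proof (rule Infinite_Sum.abs_summable_on_comparison_test[OF assms(1)])
    fix p :: "nat \<times> nat"
    obtain m n where p: "p = (m, n)" by fastforce
    have "\<rho> ^ m * \<rho> ^ n \<le> norm u ^ m * norm v ^ n"
      using \<rho> assms by (intro mult_mono power_mono) auto
    then show "norm (case p of (m, n) \<Rightarrow> norm (c m n) * \<rho> ^ (m + n))
        \<le> norm (case p of (m, n) \<Rightarrow> c m n * u ^ m * v ^ n)"
      using \<rho> by (simp add: p norm_mult norm_power power_add mult.assoc mult_left_mono)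
  qed
  then show "(\<lambda>(m, n). norm (c m n) * \<rho> ^ (m + n)) summable_on UNIV"
    by (rule abs_summable_summable)
qed

text \<open>Absolute convergence of the double series passes to each of its rows: choose a positive
  \<open>\<rho>\<close> for the variable of the rows and divide by \<open>\<rho> ^ m\<close>.\<close>

lemma converges_within_row:
  fixes c :: "nat \<Rightarrow> nat \<Rightarrow> 'a::{real_normed_field, banach}"
  assumes "converges_within c R" "norm v < R"
  shows "summable (\<lambda>n. c m n * v ^ n)"
    and "((\<lambda>n. c m n * v ^ n) has_sum (\<Sum>n. c m n * v ^ n)) UNIV"
proof -
  define \<rho> where "\<rho> = (norm v + R) / 2"
  have \<rho>: "norm v < \<rho>" "\<rho> < R" "0 < \<rho>"
    using assms(2) norm_ge_zero[of v] by (auto simp: \<rho>_def simp del: norm_ge_zero)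
  have "(\<lambda>(m, n). norm (c m n * of_real \<rho> ^ m * v ^ n)) summable_on (UNIV \<times> UNIV)"
    using abs_summable_double_series[OF assms(1), of "of_real \<rho>" v] \<rho> by (simp add: case_prod_unfold)
  then have "(\<lambda>n. norm (c m n * of_real \<rho> ^ m * v ^ n)) summable_on UNIV"
    by (rule summable_on_SigmaD1) auto
  then have "(\<lambda>n. \<rho> ^ m * norm (c m n * v ^ n)) summable_on UNIV"
    using \<rho> by (simp add: norm_mult norm_power mult_ac)
  then have "(\<lambda>n. norm (c m n * v ^ n)) summable_on UNIV"
    using \<rho> by (subst (asm) summable_on_cmult_right') auto
  then have *: "summable (\<lambda>n. norm (c m n * v ^ n))"
    by (rule summable_on_imp_summable)
  then show "summable (\<lambda>n. c m n * v ^ n)" by (rule summable_norm_cancel)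
  then show "((\<lambda>n. c m n * v ^ n) has_sum (\<Sum>n. c m n * v ^ n)) UNIV"
    using * by (intro norm_summable_imp_has_sum summable_sums) auto
qed

text \<open>Summing row by row turns the double series into an ordinary power series in the first
  variable, so that the one-variable theory applies.\<close>

lemma double_series_rows:
  fixes c :: "nat \<Rightarrow> nat \<Rightarrow> 'a::{real_normed_field, banach}"
  assumes "converges_within c R" "norm u < R" "norm v < R"
  shows "(\<lambda>m. (\<Sum>n. c m n * v ^ n) * u ^ m) sums double_series c u v"
proof -
  have "((\<lambda>(m, n). c m n * u ^ m * v ^ n) has_sum double_series c u v) (SIGMA m:UNIV. UNIV)"
    using has_sum_double_series[OF assms] by simp
  moreover have "((\<lambda>n. case (m, n) of (m, n) \<Rightarrow> c m n * u ^ m * v ^ n) has_sum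
      (\<Sum>n. c m n * v ^ n) * u ^ m) UNIV" for m
    using has_sum_cmult_left[OF converges_within_row(2)[OF assms(1,3)], of m "u ^ m"]
    by (simp add: mult_ac)
  ultimately have "((\<lambda>m. (\<Sum>n. c m n * v ^ n) * u ^ m) has_sum double_series c u v) UNIV"
    by (rule has_sum_SigmaD)
  then show ?thesis by (rule has_sum_imp_sums)
qed

lemma converges_within_transpose [simp]:
  "converges_within (transpose_coeff c) R \<longleftrightarrow> converges_within c R"
proof -
  have "(\<lambda>(m, n). norm (transpose_coeff c m n) * \<rho> ^ (m + n)) summable_on UNIV \<longleftrightarrow>
        (\<lambda>(m, n). norm (c m n) * \<rho> ^ (m + n)) summable_on UNIV" for \<rho>
    using summable_on_swap[of "\<lambda>(m, n). norm (c m n) * \<rho> ^ (m + n)" UNIV UNIV]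
    by (simp add: transpose_coeff_def add.commute)
  then show ?thesis by (simp add: converges_within_def)
qed

lemma double_series_transpose: "double_series (transpose_coeff c) u v = double_series c v u"
proof -
  have bij: "bij_betw prod.swap (UNIV :: (nat \<times> nat) set) UNIV"
    by (auto intro!: bij_betwI[of _ _ _ prod.swap])
  show ?thesis
    unfolding double_series_def transpose_coeff_def
    using infsum_reindex_bij_betw[OF bij, of "\<lambda>(m, n). c m n * v ^ m * u ^ n"]
    by (simp add: case_prod_unfold mult_ac)
qed

lemma transpose_transpose [simp]: "transpose_coeff (transpose_coeff c) = c"
  by (simp add: transpose_coeff_def fun_eq_iff)

lemma diff_coeff1_transpose: "diff_coeff1 (transpose_coeff c) = transpose_coeff (diff_coeff2 c)"
  by (simp add: diff_coeff1_def diff_coeff2_def transpose_coeff_def fun_eq_iff)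

lemma diff_coeff2_transpose: "diff_coeff2 (transpose_coeff c) = transpose_coeff (diff_coeff1 c)"
  by (simp add: diff_coeff1_def diff_coeff2_def transpose_coeff_def fun_eq_iff)

lemma diff_coeff2_diff_coeff1:
  "diff_coeff2 (diff_coeff1 c) = diff_coeff1 (diff_coeff2 (c :: nat \<Rightarrow> nat \<Rightarrow> 'a::comm_semiring_1))"
  by (simp add: diff_coeff1_def diff_coeff2_def fun_eq_iff algebra_simps)

text \<open>The factor \<open>Suc m\<close> produced by differentiation is absorbed by a slightly larger radius:
  \<open>\<sigma> ^ Suc m - \<rho> ^ Suc m\<close> is \<open>\<sigma> - \<rho>\<close> times a sum of \<open>Suc m\<close> products that are each at
  least \<open>\<rho> ^ m\<close>.\<close>

lemma Suc_times_power_le: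
  fixes \<rho> \<sigma> :: real
  assumes "0 \<le> \<rho>" "\<rho> < \<sigma>"
  shows "real (Suc m) * \<rho> ^ m \<le> \<sigma> ^ Suc m / (\<sigma> - \<rho>)"
proof -
  have "real (Suc m) * \<rho> ^ m * (\<sigma> - \<rho>) \<le> \<sigma> ^ Suc m - \<rho> ^ Suc m"
  proof (induction m)
    case (Suc m)
    have "real (Suc (Suc m)) * \<rho> ^ Suc m * (\<sigma> - \<rho>)
        = \<rho> * (real (Suc m) * \<rho> ^ m * (\<sigma> - \<rho>)) + \<rho> ^ Suc m * (\<sigma> - \<rho>)"
      by (simp add: algebra_simps)
    also have "\<dots> \<le> \<rho> * (\<sigma> ^ Suc m - \<rho> ^ Suc m) + \<rho> ^ Suc m * (\<sigma> - \<rho>)"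
      using Suc assms by (intro add_mono mult_left_mono) auto
    also have "\<dots> = \<rho> * \<sigma> ^ Suc m + \<rho> ^ Suc m * \<sigma> - 2 * \<rho> ^ Suc (Suc m)"
      by (simp add: algebra_simps)
    also have "\<dots> \<le> \<sigma> ^ Suc (Suc m) - \<rho> ^ Suc (Suc m)"
    proof -
      have "0 \<le> (\<sigma> - \<rho>) * (\<sigma> ^ Suc m - \<rho> ^ Suc m)"
        using assms by (intro mult_nonneg_nonneg) (auto intro: power_mono simp del: power_Suc)
      then show ?thesis by (simp add: algebra_simps)
    qed
    finally show ?case .
  qed simp
  also have "\<dots> \<le> \<sigma> ^ Suc m" using assms by simp
  finally show ?thesis using assms by (simp add: pos_le_divide_eq del: power_Suc)
qed

lemma converges_within_diff_coeff1:
  assumes "converges_within c R"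
  shows "converges_within (diff_coeff1 c) R"
  unfolding converges_within_def
proof (intro allI impI, elim conjE)
  fix \<rho> assume \<rho>: "0 \<le> \<rho>" "\<rho> < R"
  define \<sigma> where "\<sigma> = (\<rho> + R) / 2"
  have \<sigma>: "\<rho> < \<sigma>" "\<sigma> < R" "0 < \<sigma>" using \<rho> by (auto simp: \<sigma>_def)
  have "(\<lambda>(m, n). norm (c m n) * \<sigma> ^ (m + n)) summable_on UNIV"
    using assms \<sigma> by (auto simp: converges_within_def)
  then have "(\<lambda>(m, n). norm (c m n) * \<sigma> ^ (m + n)) summable_on range (map_prod Suc id)"
    by (rule summable_on_subset_banach) auto
  then have "(\<lambda>(m, n). norm (c (Suc m) n) * \<sigma> ^ (Suc m + n)) summable_on UNIV"
    by (subst (asm) summable_on_reindex) (auto simp: inj_on_def o_def case_prod_unfold)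
  then have *: "(\<lambda>p. (case p of (m, n) \<Rightarrow> norm (c (Suc m) n) * \<sigma> ^ (Suc m + n)) / (\<sigma> - \<rho>)) summable_on UNIV"
    unfolding divide_inverse by (rule summable_on_cmult_left)
  show "(\<lambda>(m, n). norm (diff_coeff1 c m n) * \<rho> ^ (m + n)) summable_on UNIV"
  proof (rule summable_on_comparison_test[OF *])
    fix p :: "nat \<times> nat"
    obtain m n where p: "p = (m, n)" by fastforce
    have "norm (diff_coeff1 c m n) * \<rho> ^ (m + n)
        = norm (c (Suc m) n) * ((real (Suc m) * \<rho> ^ m) * \<rho> ^ n)"
      by (simp add: diff_coeff1_def norm_mult power_add mult_ac del: of_nat_Suc)
    also have "\<dots> \<le> norm (c (Suc m) n) * ((\<sigma> ^ Suc m / (\<sigma> - \<rho>)) * \<sigma> ^ n)"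
      using \<rho> \<sigma> by (intro mult_left_mono mult_mono Suc_times_power_le power_mono) auto
    also have "\<dots> = (norm (c (Suc m) n) * \<sigma> ^ (Suc m + n)) / (\<sigma> - \<rho>)"
      by (simp add: power_add)
    finally show "(case p of (m, n) \<Rightarrow> norm (diff_coeff1 c m n) * \<rho> ^ (m + n))
        \<le> (case p of (m, n) \<Rightarrow> norm (c (Suc m) n) * \<sigma> ^ (Suc m + n)) / (\<sigma> - \<rho>)"
      by (simp add: p)
  qed (use \<rho> in auto)
qed

lemma converges_within_diff_coeff2:
  assumes "converges_within c R"
  shows "converges_within (diff_coeff2 c) R"
  by (metis assms converges_within_diff_coeff1 converges_within_transpose diff_coeff1_transpose)

text \<open>Termwise differentiation of the one-variable power series whose coefficients are the sums of
  the rows; its coefficients \<open>diffs\<close> are again sums of rows, now of the differentiated series.\<close>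

lemma has_field_derivative_double_series1:
  fixes c :: "nat \<Rightarrow> nat \<Rightarrow> 'a::{real_normed_field, banach}"
  assumes "converges_within c R" "norm u < R" "norm v < R"
  shows "((\<lambda>u. double_series c u v) has_field_derivative double_series (diff_coeff1 c) u v) (at u)"
proof -
  let ?a = "\<lambda>m. \<Sum>n. c m n * v ^ n"
  have "((\<lambda>u. \<Sum>m. ?a m * u ^ m) has_field_derivative (\<Sum>m. diffs ?a m * u ^ m)) (at u)"
    using assms(2)
    by (rule termdiffs_strong'[rotated]) (use double_series_rows[OF assms(1) _ assms(3)] in \<open>auto simp: sums_iff\<close>)
  moreover have "diffs ?a m = (\<Sum>n. diff_coeff1 c m n * v ^ n)" for m
    using suminf_mult[OF converges_within_row(1)[OF assms(1,3)], of "of_nat (Suc m)" "Suc m"]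
    by (simp add: diffs_def diff_coeff1_def mult.assoc)
  moreover have "(\<Sum>m. (\<Sum>n. diff_coeff1 c m n * v ^ n) * u ^ m) = double_series (diff_coeff1 c) u v"
    using double_series_rows[OF converges_within_diff_coeff1[OF assms(1)] assms(2,3)] by (simp add: sums_iff)
  ultimately have "((\<lambda>u. \<Sum>m. ?a m * u ^ m) has_field_derivative double_series (diff_coeff1 c) u v) (at u)"
    by simp
  moreover have "\<forall>\<^sub>F w in nhds u. (\<Sum>m. ?a m * w ^ m) = double_series c w v"
  proof -
    have "\<forall>\<^sub>F w in nhds u. norm w < R"
      using assms(2) by (intro order_tendstoD(2)[OF tendsto_norm[OF filterlim_ident]])
    then show ?thesis
      by eventually_elim (use double_series_rows[OF assms(1) _ assms(3)] in \<open>auto simp: sums_iff\<close>)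
  qed
  ultimately show ?thesis
    by (subst DERIV_cong_ev[OF refl _ refl, symmetric]) auto
qed

lemma has_field_derivative_double_series2:
  fixes c :: "nat \<Rightarrow> nat \<Rightarrow> 'a::{real_normed_field, banach}"
  assumes "converges_within c R" "norm u < R" "norm v < R"
  shows "((\<lambda>v. double_series c u v) has_field_derivative double_series (diff_coeff2 c) u v) (at v)"
  using has_field_derivative_double_series1[of "transpose_coeff c" R v u] assms
  by (simp add: double_series_transpose diff_coeff1_transpose)

text \<open>On a strictly smaller polydisc the coefficients dominate the terms uniformly, so the
  Weierstrass M-test applies.\<close>

lemma continuous_on_double_series:
  fixes c :: "nat \<Rightarrow> nat \<Rightarrow> real"
  assumes "converges_within c R"
  shows "continuous_on ({-R<..<R} \<times> {-R<..<R}) (\<lambda>(u, v). double_series c u v)"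
proof -
  have "continuous_on ({-\<rho><..<\<rho>} \<times> {-\<rho><..<\<rho>}) (\<lambda>p. \<Sum>\<^sub>\<infinity>q\<in>UNIV. case q of (m, n) \<Rightarrow> c m n * fst p ^ m * snd p ^ n)"
    if "0 \<le> \<rho>" "\<rho> < R" for \<rho>
  proof (rule uniform_limit_theorem[OF _ Weierstrass_m_test_general])
    show "(\<lambda>(m, n). norm (c m n) * \<rho> ^ (m + n)) summable_on UNIV"
      using assms that by (auto simp: converges_within_def)
    show "norm (case q of (m, n) \<Rightarrow> c m n * fst p ^ m * snd p ^ n)
        \<le> (case q of (m, n) \<Rightarrow> norm (c m n) * \<rho> ^ (m + n))"
      if p: "p \<in> {-\<rho><..<\<rho>} \<times> {-\<rho><..<\<rho>}" for p and q :: "nat \<times> nat"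
    proof -
      obtain m n where q: "q = (m, n)" by fastforce
      have "\<bar>fst p\<bar> ^ m * \<bar>snd p\<bar> ^ n \<le> \<rho> ^ m * \<rho> ^ n"
        using p by (intro mult_mono power_mono) auto
      then show ?thesis
        by (simp add: q abs_mult power_abs power_add mult.assoc mult_left_mono)
    qed
  qed (auto intro!: always_eventually continuous_intros simp: case_prod_unfold)
  then have *: "continuous_on ({-\<rho><..<\<rho>} \<times> {-\<rho><..<\<rho>}) (\<lambda>(u, v). double_series c u v)"
    if "0 \<le> \<rho>" "\<rho> < R" for \<rho>
    using that by (simp add: double_series_def case_prod_unfold)
  have "isCont (\<lambda>(u, v). double_series c u v) p" if p: "p \<in> {-R<..<R} \<times> {-R<..<R}" for p
  proof -
    obtain u v where uv: "p = (u, v)" by fastforce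
    define \<rho> where "\<rho> = (max \<bar>u\<bar> \<bar>v\<bar> + R) / 2"
    have \<rho>: "0 \<le> \<rho>" "\<rho> < R" "p \<in> {-\<rho><..<\<rho>} \<times> {-\<rho><..<\<rho>}"
      using p unfolding uv \<rho>_def by (auto simp: max_def abs_if field_simps)
    have "open ({-\<rho><..<\<rho>} \<times> {-\<rho><..<\<rho>})" by (simp add: open_Times)
    then show ?thesis
      using *[OF \<rho>(1,2)] \<rho>(3) by (simp only: continuous_on_eq_continuous_at)
  qed
  then show ?thesis by (rule continuous_at_imp_continuous_on[OF ballI])
qed

lemma has_derivative_double_series:
  fixes c :: "nat \<Rightarrow> nat \<Rightarrow> real"
  assumes c: "converges_within c R" and "\<bar>u\<bar> < R" "\<bar>v\<bar> < R"
  shows "((\<lambda>(u, v). double_series c u v) has_derivative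
    (\<lambda>(x, y). double_series (diff_coeff1 c) u v * x + double_series (diff_coeff2 c) u v * y)) (at (u, v))"
proof -
  let ?I = "{-R<..<R}" and ?q = "double_series (diff_coeff2 c)"
  have I: "u \<in> ?I" "v \<in> ?I" using assms by auto
  have "((\<lambda>(u, v). double_series c u v) has_derivative
      (\<lambda>(x, y). double_series (diff_coeff1 c) u v * x + blinfun_scaleR_left (?q u v) y)) (at (u, v) within ?I \<times> ?I)"
  proof (rule has_derivative_partialsI)
    show "((\<lambda>u. double_series c u v) has_derivative (*) (double_series (diff_coeff1 c) u v)) (at u within ?I)"
      using has_field_derivative_double_series1[OF c, of u v] assms
      by (auto simp: has_field_derivative_def intro: has_derivative_at_withinI)
    show "(double_series c x has_derivative blinfun_apply (blinfun_scaleR_left (?q x y))) (at y within ?I)"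
      if "x \<in> ?I" "y \<in> ?I" for x y
      using has_field_derivative_double_series2[OF c, of x y] that
      by (auto simp: has_field_derivative_def mult_commute_abs abs_less_iff intro!: has_derivative_at_withinI)
    have "continuous (at (u, v) within ?I \<times> ?I) (\<lambda>(x, y). ?q x y)"
      using continuous_on_double_series[OF converges_within_diff_coeff2[OF c]] I
      by (auto simp: continuous_on_eq_continuous_within)
    then show "continuous (at (u, v) within ?I \<times> ?I) (\<lambda>(x, y). blinfun_scaleR_left (?q x y))"
      unfolding case_prod_unfold
      by (rule bounded_linear.continuous[OF bounded_linear_blinfun_scaleR_left])
  qed (use I in auto)
  moreover have "at (u, v) within ?I \<times> ?I = at (u, v)"
    using I by (intro at_within_open) (auto simp: open_Times)
  ultimately show ?thesis by (simp add: mult.commute)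
qed

lemma has_sum_binomial_product:
  fixes p q X Y :: real
  shows "((\<lambda>(j, k). (of_nat (m choose j) * X ^ j * p ^ (m - j)) * (of_nat (n choose k) * Y ^ k * q ^ (n - k)))
      has_sum (X + p) ^ m * (Y + q) ^ n) UNIV"
proof (rule has_sum_finite_neutralI[where B = "{..m} \<times> {..n}"])
  show "(X + p) ^ m * (Y + q) ^ n = (\<Sum>(j, k)\<in>{..m} \<times> {..n}.
      (of_nat (m choose j) * X ^ j * p ^ (m - j)) * (of_nat (n choose k) * Y ^ k * q ^ (n - k)))"
    unfolding binomial_ring sum_product sum.cartesian_product ..
qed auto

text \<open>Expanding both powers by the binomial theorem yields a sum over four indices. It converges
  absolutely as soon as \<open>\<bar>x - p\<bar> + \<bar>p\<bar> < R\<close> and \<open>\<bar>y - q\<bar> + \<bar>q\<bar> < R\<close>, because the binomial theorem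
  with absolute values sums it back to the original series at \<open>(\<bar>x - p\<bar> + \<bar>p\<bar>, \<bar>y - q\<bar> + \<bar>q\<bar>)\<close>. Hence the
  order of summation may be exchanged.\<close>

lemma double_series_recenter:
  fixes c :: "nat \<Rightarrow> nat \<Rightarrow> real"
  assumes c: "converges_within c R" and "\<bar>p\<bar> < R" "\<bar>q\<bar> < R"
  shows "\<exists>c'. \<forall>\<^sub>F (x, y) in nhds (p, q).
    ((\<lambda>(m, n). c' m n * (x - p) ^ m * (y - q) ^ n) has_sum double_series c x y) UNIV"
proof -
  define B where "B m n j k X Y p q =
    (of_nat (m choose j) * X ^ j * p ^ (m - j)) * (of_nat (n choose k) * Y ^ k * q ^ (n - k))"
    for m n j k and X Y p q :: real
  have B: "((\<lambda>(j, k). B m n j k X Y p q) has_sum (X + p) ^ m * (Y + q) ^ n) UNIV" for m n X Y p q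
    unfolding B_def by (rule has_sum_binomial_product)
  define c' where "c' j k = (\<Sum>\<^sub>\<infinity>(m, n). c m n * B m n j k 1 1 p q)" for j k
  have main: "((\<lambda>(j, k). c' j k * (x - p) ^ j * (y - q) ^ k) has_sum double_series c x y) UNIV"
    if xy: "\<bar>x - p\<bar> + \<bar>p\<bar> < R" "\<bar>y - q\<bar> + \<bar>q\<bar> < R" for x y
  proof -
    define X Y where "X = x - p" and "Y = y - q"
    define G where "G = (\<lambda>((m, n), (j, k)). c m n * B m n j k X Y p q)"
    have Babs: "\<bar>B m n j k X Y p q\<bar> = B m n j k \<bar>X\<bar> \<bar>Y\<bar> \<bar>p\<bar> \<bar>q\<bar>" for m n j k
      by (simp add: B_def abs_mult power_abs)
    have "(\<lambda>z. \<bar>G z\<bar>) summable_on (UNIV \<times> UNIV)"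
    proof (rule summable_on_SigmaI)
      show "((\<lambda>w. \<bar>G (z, w)\<bar>) has_sum
          (case z of (m, n) \<Rightarrow> \<bar>c m n * (\<bar>X\<bar> + \<bar>p\<bar>) ^ m * (\<bar>Y\<bar> + \<bar>q\<bar>) ^ n\<bar>)) UNIV" for z
        using has_sum_cmult_right[OF B, of "\<bar>c (fst z) (snd z)\<bar>" "fst z" "snd z" "\<bar>X\<bar>" "\<bar>Y\<bar>" "\<bar>p\<bar>" "\<bar>q\<bar>"]
        by (simp add: G_def case_prod_unfold abs_mult Babs mult.assoc power_abs)
      show "(\<lambda>(m, n). \<bar>c m n * (\<bar>X\<bar> + \<bar>p\<bar>) ^ m * (\<bar>Y\<bar> + \<bar>q\<bar>) ^ n\<bar>) summable_on UNIV"
        using abs_summable_double_series[OF c, of "\<bar>X\<bar> + \<bar>p\<bar>" "\<bar>Y\<bar> + \<bar>q\<bar>"] xy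
        by (simp add: X_def Y_def case_prod_unfold)
    qed auto
    then have G: "G summable_on (UNIV \<times> UNIV)"
      using summable_on_iff_abs_summable_on_real[of G] by simp
    then obtain S where S: "(G has_sum S) (UNIV \<times> UNIV)" by (auto simp: summable_on_def)
    have "((\<lambda>w. G (z, w)) has_sum (case z of (m, n) \<Rightarrow> c m n * x ^ m * y ^ n)) UNIV" for z
      using has_sum_cmult_right[OF B, of "c (fst z) (snd z)" "fst z" "snd z" X Y p q]
      by (simp add: G_def case_prod_unfold X_def Y_def mult.assoc)
    then have "((\<lambda>(m, n). c m n * x ^ m * y ^ n) has_sum S) UNIV"
      by (rule has_sum_SigmaD[OF S])
    moreover have "((\<lambda>(m, n). c m n * x ^ m * y ^ n) has_sum double_series c x y) UNIV"
      using xy by (intro has_sum_double_series[OF c]) auto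
    ultimately have "S = double_series c x y" by (rule has_sum_unique)
    then have S': "((\<lambda>(w, z). G (z, w)) has_sum double_series c x y) (UNIV \<times> UNIV)"
      using S by (subst (asm) has_sum_swap) simp
    have "((\<lambda>z. case (w, z) of (w, z) \<Rightarrow> G (z, w)) has_sum (case w of (j, k) \<Rightarrow> c' j k * X ^ j * Y ^ k)) UNIV" for w
    proof -
      obtain j k where w: "w = (j, k)" by fastforce
      have "(\<lambda>z. G (z, w)) summable_on UNIV"
        by (rule summable_on_SigmaD1[OF has_sum_imp_summable[OF S']]) simp
      then have "((\<lambda>z. G (z, w)) has_sum (\<Sum>\<^sub>\<infinity>z. G (z, w))) UNIV" by simp
      also have "(\<lambda>z. G (z, w)) = (\<lambda>z. (case z of (m, n) \<Rightarrow> c m n * B m n j k 1 1 p q) * (X ^ j * Y ^ k))"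
        by (auto simp: G_def w B_def fun_eq_iff mult_ac)
      then have "(\<Sum>\<^sub>\<infinity>z. G (z, w)) = c' j k * X ^ j * Y ^ k"
        by (simp only: infsum_cmult_left' c'_def mult.assoc)
      finally show ?thesis by (simp add: w)
    qed
    then show ?thesis
      unfolding X_def[symmetric] Y_def[symmetric] by (rule has_sum_SigmaD[OF S'])
  qed
  have "((\<lambda>z. \<bar>fst z - p\<bar> + \<bar>p\<bar>) \<longlongrightarrow> \<bar>fst (p, q) - p\<bar> + \<bar>p\<bar>) (nhds (p, q))"
    by (intro tendsto_intros filterlim_ident)
  then have 1: "\<forall>\<^sub>F z in nhds (p, q). \<bar>fst z - p\<bar> + \<bar>p\<bar> < R"
    by (rule order_tendstoD(2)) (use assms in simp)
  have "((\<lambda>z. \<bar>snd z - q\<bar> + \<bar>q\<bar>) \<longlongrightarrow> \<bar>snd (p, q) - q\<bar> + \<bar>q\<bar>) (nhds (p, q))"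
    by (intro tendsto_intros filterlim_ident)
  then have 2: "\<forall>\<^sub>F z in nhds (p, q). \<bar>snd z - q\<bar> + \<bar>q\<bar> < R"
    by (rule order_tendstoD(2)) (use assms in simp)
  have "\<forall>\<^sub>F (x, y) in nhds (p, q).
      ((\<lambda>(m, n). c' m n * (x - p) ^ m * (y - q) ^ n) has_sum double_series c x y) UNIV"
    using 1 2
  proof eventually_elim
    case (elim z)
    then show ?case using main[of "fst z" "snd z"] by (cases z) simp
  qed
  then show ?thesis by blast
qed

section \<open>Graphs in Euclidean and Lorentz-Minkowski space\<close>

text \<open>One form covers both ambient metrics, so that unit normals and shape operators of graphs need
  to be computed only once.\<close>

definition diagonal_form :: "real \<Rightarrow> real^3 \<Rightarrow> real^3 \<Rightarrow> real" where
  "diagonal_form \<sigma> v w = \<sigma> * (v $ 1 * w $ 1) + v $ 2 * w $ 2 + v $ 3 * w $ 3"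

lemma inner_eq_diagonal_form: "inner = diagonal_form 1"
  by (simp add: fun_eq_iff diagonal_form_def inner_vec_def sum_3)

lemma lorentz_eq_diagonal_form: "lorentz = diagonal_form (-1)"
  by (simp add: fun_eq_iff diagonal_form_def lorentz_def)

lemma vector_3_eq_scaleR:
  "(vector [a, b, c] :: real^3) = a *\<^sub>R vector [1, 0, 0] + b *\<^sub>R vector [0, 1, 0] + c *\<^sub>R vector [0, 0, 1]"
  by (simp add: vec_eq_iff forall_3)

lemma has_vector_derivative_vector_3:
  assumes "(f has_real_derivative f') (at x)" "(g has_real_derivative g') (at x)"
    "(k has_real_derivative k') (at x)"
  shows "((\<lambda>x. vector [f x, g x, k x] :: real^3) has_vector_derivative vector [f', g', k']) (at x)"
  unfolding vector_3_eq_scaleR[of "f _"] vector_3_eq_scaleR[of f']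
  using assms by (auto intro!: derivative_eq_intros)

text \<open>For a graph with slopes \<open>P\<close> and \<open>Q\<close> the unit normal is \<open>(- \<sigma> P, - Q, 1)\<close> divided by its length.
  The lemma differentiates this expression along a coordinate line.\<close>

lemma has_vector_derivative_unit_normal:
  fixes P Q :: "real \<Rightarrow> real"
  assumes P: "(P has_real_derivative P') (at x)" and Q: "(Q has_real_derivative Q') (at x)"
    and \<sigma>: "\<sigma> * \<sigma> = 1" and W: "W = 1 + \<sigma> * (P x)\<^sup>2 + (Q x)\<^sup>2" "W > 0"
  shows "((\<lambda>x. (1 / sqrt (1 + \<sigma> * (P x)\<^sup>2 + (Q x)\<^sup>2)) *\<^sub>R (vector [- \<sigma> * P x, - Q x, 1] :: real^3))
    has_vector_derivative - (1 / (W * sqrt W)) *\<^sub>R vector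
      [\<sigma> * ((1 + (Q x)\<^sup>2) * P' - P x * Q x * Q'),
       (1 + \<sigma> * (P x)\<^sup>2) * Q' - \<sigma> * P x * Q x * P',
       \<sigma> * P x * P' + Q x * Q']) (at x)"
proof -
  define J where "J = \<sigma> * P x * P' + Q x * Q'"
  (* J is half the derivative of the squared length W, and w is the factor W^(-3/2). *)
  define w where "w = 1 / (W * sqrt W)"
  have w: "1 / sqrt W = W * w" using W(2) by (simp add: w_def)
  have d: "((\<lambda>x. 1 + \<sigma> * (P x)\<^sup>2 + (Q x)\<^sup>2) has_real_derivative 2 * J) (at x)"
    unfolding J_def power2_eq_square
    by (rule DERIV_cong[OF DERIV_add[OF DERIV_add[OF DERIV_const DERIV_cmult[OF DERIV_mult[OF P P]]]
          DERIV_mult[OF Q Q]]]) (simp add: algebra_simps)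
  have "((\<lambda>x. sqrt (1 + \<sigma> * (P x)\<^sup>2 + (Q x)\<^sup>2)) has_real_derivative inverse (sqrt W) / 2 * (2 * J)) (at x)"
    unfolding W(1) by (rule DERIV_chain2[where f = sqrt and x = x and g = "\<lambda>x. 1 + \<sigma> * (P x)\<^sup>2 + (Q x)\<^sup>2",
          OF DERIV_real_sqrt[OF W(2)[unfolded W(1)]] d])
  then have "((\<lambda>x. sqrt (1 + \<sigma> * (P x)\<^sup>2 + (Q x)\<^sup>2)) has_real_derivative J / sqrt W) (at x)"
    by (simp add: field_simps)
  then have inv: "((\<lambda>x. 1 / sqrt (1 + \<sigma> * (P x)\<^sup>2 + (Q x)\<^sup>2)) has_real_derivative - J * w) (at x)"
    using DERIV_inverse_fun[of "\<lambda>x. sqrt (1 + \<sigma> * (P x)\<^sup>2 + (Q x)\<^sup>2)" "J / sqrt W" x] W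
    by (simp add: w_def divide_inverse mult_ac)
  have vec: "((\<lambda>x. vector [- \<sigma> * P x, - Q x, 1] :: real^3) has_vector_derivative vector [- \<sigma> * P', - Q', 0]) (at x)"
    by (intro has_vector_derivative_vector_3) (auto intro!: derivative_eq_intros P Q)
  have eq: "(1 / sqrt W) *\<^sub>R (vector [- \<sigma> * P', - Q', 0] :: real^3) + (- J * w) *\<^sub>R vector [- \<sigma> * P x, - Q x, 1]
    = - w *\<^sub>R vector
      [\<sigma> * ((1 + (Q x)\<^sup>2) * P' - P x * Q x * Q'),
       (1 + \<sigma> * (P x)\<^sup>2) * Q' - \<sigma> * P x * Q x * P', J]"
    unfolding w by (simp add: vec_eq_iff forall_3 W(1) J_def algebra_simps power2_eq_square)
  show ?thesis
    using has_vector_derivative_scaleR[OF inv vec] unfolding W(1)[symmetric] eq unfolding w_def J_def .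
qed

text \<open>In the coordinate frame the induced metric has the matrix with rows \<open>(p\<^sup>2 - 1, p q)\<close> and
  \<open>(p q, 1 + q\<^sup>2)\<close>. Its determinant is \<open>- (1 - p\<^sup>2 + q\<^sup>2) < 0\<close> and its second diagonal entry is positive,
  so the signature is \<open>(-, +)\<close>.\<close>

lemma timelike_at_graph:
  assumes "((\<lambda>x. h x v) has_real_derivative p) (at u)" "(h u has_real_derivative q) (at v)"
    and W: "1 - p\<^sup>2 + q\<^sup>2 > 0"
  shows "timelike_at (graph_surface h) u v"
proof -
  have 1: "partial1 (graph_surface h) u v = vector [1, 0, p]"
    unfolding partial1_def graph_surface_def
    by (intro vector_derivative_at has_vector_derivative_vector_3 assms) auto
  have 2: "partial2 (graph_surface h) u v = vector [0, 1, q]"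
    unfolding partial2_def graph_surface_def
    by (intro vector_derivative_at has_vector_derivative_vector_3) (use assms(2) in auto)
  define G where "G = 1 + q\<^sup>2"
  define D where "D = 1 - p\<^sup>2 + q\<^sup>2"
  have G: "G > 0" by (simp add: G_def add_pos_nonneg)
  have D: "D > 0" using W by (simp add: D_def)
  have form: "first_form lorentz (graph_surface h) u v a b =
      (p\<^sup>2 - 1) * a $ 1 * b $ 1 + p * q * (a $ 1 * b $ 2 + a $ 2 * b $ 1) + G * a $ 2 * b $ 2" for a b
    by (simp add: first_form_def surf_differential_def lorentz_def 1 2 G_def algebra_simps power2_eq_square)
  (* b is the normalised second coordinate vector and a spans its orthogonal complement. *)
  define a :: "real^2" where "a = (1 / sqrt (G * D)) *\<^sub>R vector [G, - p * q]"
  define b :: "real^2" where "b = (1 / sqrt G) *\<^sub>R vector [0, 1]"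
  have "first_form lorentz (graph_surface h) u v a a
      = (1 / sqrt (G * D))\<^sup>2 * ((p\<^sup>2 - 1) * G\<^sup>2 - 2 * (p * q)\<^sup>2 * G + G * (p * q)\<^sup>2)"
  proof -
    have "first_form lorentz (graph_surface h) u v (e *\<^sub>R vector [G, - p * q]) (e *\<^sub>R vector [G, - p * q])
      = e\<^sup>2 * ((p\<^sup>2 - 1) * G\<^sup>2 - 2 * (p * q)\<^sup>2 * G + G * (p * q)\<^sup>2)" for e
      by (simp add: form power2_eq_square algebra_simps)
    then show ?thesis unfolding a_def .
  qed
  also have "(1 / sqrt (G * D))\<^sup>2 = 1 / (G * D)" using G D by (simp add: power_divide)
  also have "(p\<^sup>2 - 1) * G\<^sup>2 - 2 * (p * q)\<^sup>2 * G + G * (p * q)\<^sup>2 = - (G * D)"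
    by (simp add: G_def D_def power2_eq_square algebra_simps)
  finally have aa: "first_form lorentz (graph_surface h) u v a a = -1" using G D by simp
  have bb: "first_form lorentz (graph_surface h) u v b b = 1" using G by (simp add: form b_def)
  have ab: "first_form lorentz (graph_surface h) u v a b = 0" by (simp add: form a_def b_def)
  show ?thesis unfolding timelike_at_def lorentzian_form_def using aa bb ab by blast
qed

text \<open>The first two components of the equation \<open>d\<nu> = - dX \<circ> S\<close> determine \<open>S\<close>, because \<open>dX\<close> is the identity
  there: the entries of \<open>S\<close> are minus the partial derivatives of the first two components of \<open>\<nu>\<close>. The
  third component then holds because \<open>\<nu>\<close> has constant length. The assumption \<open>\<sigma> * \<sigma> = 1\<close> is what
  makes \<open>\<nu>\<close> a unit vector orthogonal to the surface.\<close>

lemma graph_has_shape_operator: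
  fixes h p q :: "real \<Rightarrow> real \<Rightarrow> real"
  assumes \<sigma>: "\<sigma> * \<sigma> = 1" and \<Omega>: "open \<Omega>" "(u, v) \<in> \<Omega>"
    and h1: "\<And>a b. (a, b) \<in> \<Omega> \<Longrightarrow> ((\<lambda>x. h x b) has_real_derivative p a b) (at a)"
    and h2: "\<And>a b. (a, b) \<in> \<Omega> \<Longrightarrow> (h a has_real_derivative q a b) (at b)"
    and p: "(\<lambda>(a, b). p a b) differentiable_on \<Omega>" and q: "(\<lambda>(a, b). q a b) differentiable_on \<Omega>"
    and W: "\<And>a b. (a, b) \<in> \<Omega> \<Longrightarrow> 1 + \<sigma> * (p a b)\<^sup>2 + (q a b)\<^sup>2 > 0"
    and p1: "((\<lambda>x. p x v) has_real_derivative r) (at u)" and p2: "(p u has_real_derivative s) (at v)"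
    and q1: "((\<lambda>x. q x v) has_real_derivative s) (at u)" and q2: "(q u has_real_derivative t) (at v)"
  defines "w \<equiv> 1 + \<sigma> * (p u v)\<^sup>2 + (q u v)\<^sup>2"
  shows "\<exists>\<nu>. diagonal_form \<sigma> (\<nu> u v) (\<nu> u v) = 1 \<and>
    has_shape_operator (diagonal_form \<sigma>) (graph_surface h) u v \<nu>
      ((1 / (w * sqrt w)) *\<^sub>R vector
        [vector [\<sigma> * ((1 + (q u v)\<^sup>2) * r - p u v * q u v * s), \<sigma> * ((1 + (q u v)\<^sup>2) * s - p u v * q u v * t)],
         vector [(1 + \<sigma> * (p u v)\<^sup>2) * s - \<sigma> * p u v * q u v * r, (1 + \<sigma> * (p u v)\<^sup>2) * t - \<sigma> * p u v * q u v * s]])"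
    (is "\<exists>\<nu>. _ \<and> has_shape_operator _ _ _ _ _ ?S")
proof -
  define \<nu> where "\<nu> a b = (1 / sqrt (1 + \<sigma> * (p a b)\<^sup>2 + (q a b)\<^sup>2)) *\<^sub>R (vector [- \<sigma> * p a b, - q a b, 1] :: real^3)"
    for a b
  have w: "w > 0" unfolding w_def by (rule W[OF \<Omega>(2)])
  have X1: "partial1 (graph_surface h) a b = vector [1, 0, p a b]" if "(a, b) \<in> \<Omega>" for a b
    unfolding partial1_def graph_surface_def
    by (intro vector_derivative_at has_vector_derivative_vector_3 h1 that) auto
  have X2: "partial2 (graph_surface h) a b = vector [0, 1, q a b]" if "(a, b) \<in> \<Omega>" for a b
    unfolding partial2_def graph_surface_def
    by (intro vector_derivative_at has_vector_derivative_vector_3) (use h2[OF that] in auto)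
  have norm: "diagonal_form \<sigma> (\<nu> a b) (\<nu> a b) = 1" if "(a, b) \<in> \<Omega>" for a b
  proof -
    have "diagonal_form \<sigma> (e *\<^sub>R vector [- \<sigma> * P, - Q, 1]) (e *\<^sub>R vector [- \<sigma> * P, - Q, 1])
        = e\<^sup>2 * (\<sigma> * \<sigma> * \<sigma> * P\<^sup>2 + Q\<^sup>2 + 1)" for e P Q
      by (simp add: diagonal_form_def power2_eq_square algebra_simps)
    then have "diagonal_form \<sigma> (\<nu> a b) (\<nu> a b) = (1 / sqrt (1 + \<sigma> * (p a b)\<^sup>2 + (q a b)\<^sup>2))\<^sup>2
        * (\<sigma> * \<sigma> * \<sigma> * (p a b)\<^sup>2 + (q a b)\<^sup>2 + 1)"
      unfolding \<nu>_def .
    also have "\<dots> = 1" using W[OF that] by (simp add: \<sigma> power_divide add_ac)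
    finally show ?thesis .
  qed
  have orth: "diagonal_form \<sigma> (\<nu> a b) (surf_differential (graph_surface h) a b c) = 0" if "(a, b) \<in> \<Omega>" for a b c
  proof -
    have "diagonal_form \<sigma> (e *\<^sub>R vector [- \<sigma> * P, - Q, 1]) (x *\<^sub>R vector [1, 0, P] + y *\<^sub>R vector [0, 1, Q])
      = e * (P * x * (1 - \<sigma> * \<sigma>))" for e P Q x y
      by (simp add: diagonal_form_def algebra_simps)
    then have "diagonal_form \<sigma> (\<nu> a b) (surf_differential (graph_surface h) a b c)
      = (1 / sqrt (1 + \<sigma> * (p a b)\<^sup>2 + (q a b)\<^sup>2)) * (p a b * c $ 1 * (1 - \<sigma> * \<sigma>))"
      unfolding \<nu>_def surf_differential_def X1[OF that] X2[OF that] .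
    then show ?thesis by (simp add: \<sigma>)
  qed
  have "(\<lambda>(a, b). \<nu> a b) differentiable_on \<Omega>"
    unfolding differentiable_on_def
  proof
    fix z assume z: "z \<in> \<Omega>"
    have "(\<lambda>z. p (fst z) (snd z)) differentiable (at z within \<Omega>)"
      "(\<lambda>z. q (fst z) (snd z)) differentiable (at z within \<Omega>)"
      using p q z by (auto simp: differentiable_on_def case_prod_unfold)
    then obtain p' q' where d: "((\<lambda>z. p (fst z) (snd z)) has_derivative p') (at z within \<Omega>)"
      "((\<lambda>z. q (fst z) (snd z)) has_derivative q') (at z within \<Omega>)"
      by (auto simp: differentiable_def)
    have pos: "1 + \<sigma> * (p (fst z) (snd z))\<^sup>2 + (q (fst z) (snd z))\<^sup>2 > 0" using W z by simp
    have "(\<lambda>z. 1 / sqrt (1 + \<sigma> * (p (fst z) (snd z))\<^sup>2 + (q (fst z) (snd z))\<^sup>2)) differentiable (at z within \<Omega>)"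
      unfolding differentiable_def using pos
      by (auto intro!: exI derivative_eq_intros d)
    moreover have "(\<lambda>z. vector [- \<sigma> * p (fst z) (snd z), - q (fst z) (snd z), 1] :: real^3) differentiable (at z within \<Omega>)"
      unfolding differentiable_def vector_3_eq_scaleR[of "- \<sigma> * p (fst _) (snd _)"]
      by (auto intro!: exI derivative_eq_intros d)
    ultimately show "(\<lambda>(a, b). \<nu> a b) differentiable (at z within \<Omega>)"
      unfolding \<nu>_def case_prod_unfold by (rule differentiable_scaleR)
  qed
  then have normal: "unit_normal_on (diagonal_form \<sigma>) (graph_surface h) \<Omega> \<nu>"
    unfolding unit_normal_on_def using norm orth by auto
  have N1: "partial1 \<nu> u v = - (1 / (w * sqrt w)) *\<^sub>R vector
      [\<sigma> * ((1 + (q u v)\<^sup>2) * r - p u v * q u v * s), (1 + \<sigma> * (p u v)\<^sup>2) * s - \<sigma> * p u v * q u v * r,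
       \<sigma> * p u v * r + q u v * s]"
    unfolding partial1_def \<nu>_def
    by (rule vector_derivative_at, rule has_vector_derivative_unit_normal[OF p1 q1 \<sigma> _ w]) (simp add: w_def)
  have N2: "partial2 \<nu> u v = - (1 / (w * sqrt w)) *\<^sub>R vector
      [\<sigma> * ((1 + (q u v)\<^sup>2) * s - p u v * q u v * t), (1 + \<sigma> * (p u v)\<^sup>2) * t - \<sigma> * p u v * q u v * s,
       \<sigma> * p u v * s + q u v * t]"
    unfolding partial2_def \<nu>_def
    by (rule vector_derivative_at, rule has_vector_derivative_unit_normal[OF p2 q2 \<sigma> _ w]) (simp add: w_def)
  have "surf_differential \<nu> u v c = - surf_differential (graph_surface h) u v (?S *v c)" for c
  proof -
    have "x *\<^sub>R (- e *\<^sub>R vector [\<sigma> * ((1 + Q\<^sup>2) * r - P * Q * s),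
          (1 + \<sigma> * P\<^sup>2) * s - \<sigma> * P * Q * r, \<sigma> * P * r + Q * s])
        + y *\<^sub>R (- e *\<^sub>R vector [\<sigma> * ((1 + Q\<^sup>2) * s - P * Q * t),
          (1 + \<sigma> * P\<^sup>2) * t - \<sigma> * P * Q * s, \<sigma> * P * s + Q * t])
      = - (((e *\<^sub>R A) *v c) $ 1 *\<^sub>R vector [1, 0, P] + ((e *\<^sub>R A) *v c) $ 2 *\<^sub>R (vector [0, 1, Q] :: real^3))"
      if "A = vector [vector [\<sigma> * ((1 + Q\<^sup>2) * r - P * Q * s), \<sigma> * ((1 + Q\<^sup>2) * s - P * Q * t)],
         vector [(1 + \<sigma> * P\<^sup>2) * s - \<sigma> * P * Q * r, (1 + \<sigma> * P\<^sup>2) * t - \<sigma> * P * Q * s]]"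
        "x = c $ 1" "y = c $ 2" for e P Q x y and A :: "real^2^2" and c :: "real^2"
      unfolding vec_eq_iff forall_3 that
      by (simp add: matrix_vector_mult_def sum_2 algebra_simps power2_eq_square)
    from this[OF refl refl refl] show ?thesis
      unfolding surf_differential_def X1[OF \<Omega>(2)] X2[OF \<Omega>(2)] N1 N2 .
  qed
  then show ?thesis
    unfolding has_shape_operator_def using \<Omega> normal norm by blast
qed

lemma graph_has_gauss_curvature:
  fixes h p q :: "real \<Rightarrow> real \<Rightarrow> real"
  assumes \<Omega>: "open \<Omega>" "(u, v) \<in> \<Omega>"
    and h1: "\<And>a b. (a, b) \<in> \<Omega> \<Longrightarrow> ((\<lambda>x. h x b) has_real_derivative p a b) (at a)"
    and h2: "\<And>a b. (a, b) \<in> \<Omega> \<Longrightarrow> (h a has_real_derivative q a b) (at b)"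
    and p: "(\<lambda>(a, b). p a b) differentiable_on \<Omega>" and q: "(\<lambda>(a, b). q a b) differentiable_on \<Omega>"
    and W: "\<And>a b. (a, b) \<in> \<Omega> \<Longrightarrow> 1 - (p a b)\<^sup>2 + (q a b)\<^sup>2 > 0"
    and p1: "((\<lambda>x. p x v) has_real_derivative r) (at u)" and p2: "(p u has_real_derivative s) (at v)"
    and q1: "((\<lambda>x. q x v) has_real_derivative s) (at u)" and q2: "(q u has_real_derivative t) (at v)"
  shows "has_gauss_curvature lorentz (graph_surface h) u v
    (- (r * t - s\<^sup>2) / (1 - (p u v)\<^sup>2 + (q u v)\<^sup>2)\<^sup>2)"
proof -
  define w where "w = 1 - (p u v)\<^sup>2 + (q u v)\<^sup>2"
  have w: "w > 0" unfolding w_def by (rule W[OF \<Omega>(2)])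
  define S :: "real^2^2" where "S = (1 / (w * sqrt w)) *\<^sub>R vector
        [vector [- ((1 + (q u v)\<^sup>2) * r - p u v * q u v * s), - ((1 + (q u v)\<^sup>2) * s - p u v * q u v * t)],
         vector [(1 - (p u v)\<^sup>2) * s + p u v * q u v * r, (1 - (p u v)\<^sup>2) * t + p u v * q u v * s]]"
  obtain \<nu> where \<nu>: "lorentz (\<nu> u v) (\<nu> u v) = 1" "has_shape_operator lorentz (graph_surface h) u v \<nu> S"
    using graph_has_shape_operator[of "-1", OF _ \<Omega> h1 h2 p q _ p1 p2 q1 q2] W
    by (auto simp: lorentz_eq_diagonal_form S_def w_def)
  have "det S = (1 / (w * sqrt w))\<^sup>2 * (- w * (r * t - s\<^sup>2))"
  proof -
    have "det (e *\<^sub>R vector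
        [vector [- ((1 + Q\<^sup>2) * r - P * Q * s), - ((1 + Q\<^sup>2) * s - P * Q * t)],
         vector [(1 - P\<^sup>2) * s + P * Q * r, (1 - P\<^sup>2) * t + P * Q * s]] :: real^2^2)
      = e\<^sup>2 * (- (1 - P\<^sup>2 + Q\<^sup>2) * (r * t - s\<^sup>2))" for e P Q
      unfolding det_2 by (simp add: power2_eq_square algebra_simps)
    then show ?thesis unfolding S_def w_def .
  qed
  also have "\<dots> = - (r * t - s\<^sup>2) / w\<^sup>2"
    using w by (simp add: power_divide power_mult_distrib) (simp add: power2_eq_square field_simps)
  finally show ?thesis
    unfolding has_gauss_curvature_def w_def[symmetric] using \<nu> by (metis mult_1)
qed

text \<open>If the Hessian of the height function vanishes, so does the shape operator, and the point is a
  flat umbilic.\<close>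

lemma graph_umbilic_if_flat:
  fixes h p q :: "real \<Rightarrow> real \<Rightarrow> real"
  assumes \<Omega>: "open \<Omega>" "(u, v) \<in> \<Omega>"
    and h1: "\<And>a b. (a, b) \<in> \<Omega> \<Longrightarrow> ((\<lambda>x. h x b) has_real_derivative p a b) (at a)"
    and h2: "\<And>a b. (a, b) \<in> \<Omega> \<Longrightarrow> (h a has_real_derivative q a b) (at b)"
    and p: "(\<lambda>(a, b). p a b) differentiable_on \<Omega>" and q: "(\<lambda>(a, b). q a b) differentiable_on \<Omega>"
    and p1: "((\<lambda>x. p x v) has_real_derivative 0) (at u)" and p2: "(p u has_real_derivative 0) (at v)"
    and q1: "((\<lambda>x. q x v) has_real_derivative 0) (at u)" and q2: "(q u has_real_derivative 0) (at v)"
  shows "umbilic_at inner (graph_surface h) u v"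
proof -
  have pos: "1 + 1 * (p a b)\<^sup>2 + (q a b)\<^sup>2 > 0" for a b by (simp add: add_pos_nonneg)
  have z: "(vector [vector [0, 0], vector [0, 0]] :: real^2^2) = 0"
    by (simp add: vec_eq_iff forall_2)
  obtain \<nu> where "has_shape_operator inner (graph_surface h) u v \<nu> (0 *\<^sub>R mat 1)"
    using graph_has_shape_operator[of 1, OF _ \<Omega> h1 h2 p q pos p1 p2 q1 q2]
    by (auto simp: inner_eq_diagonal_form z)
  then show ?thesis unfolding umbilic_at_def by blast
qed

section \<open>Functions given by a double power series near a point\<close>

lemma double_series_0_0: "double_series c 0 0 = c 0 0"
proof -
  have "((\<lambda>(m, n). c m n * 0 ^ m * 0 ^ n) has_sum c 0 0) UNIV"
    by (rule has_sum_finite_neutralI[where B = "{(0, 0)}"]) (auto simp: power_0_left split: if_splits)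
  then show ?thesis unfolding double_series_def by (rule infsumI)
qed

text \<open>The region is the open square of half-width \<open>R\<close> about \<open>(a, b)\<close>. Carrying the coefficients along
  allows partial derivatives, rotation and symmetry to be read off from them.\<close>

definition expands_as ::
    "(real \<Rightarrow> real \<Rightarrow> real) \<Rightarrow> real \<Rightarrow> real \<Rightarrow> (nat \<Rightarrow> nat \<Rightarrow> real) \<Rightarrow> real \<Rightarrow> bool" where
  "expands_as f a b c R \<longleftrightarrow> 0 < R \<and> converges_within c R \<and>
     (\<forall>x y. \<bar>x - a\<bar> < R \<and> \<bar>y - b\<bar> < R \<longrightarrow> f x y = double_series c (x - a) (y - b))"

lemma expands_asD:
  assumes "expands_as f a b c R"
  shows "0 < R" "converges_within c R"
    "\<bar>x - a\<bar> < R \<Longrightarrow> \<bar>y - b\<bar> < R \<Longrightarrow> f x y = double_series c (x - a) (y - b)"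
  using assms unfolding expands_as_def by blast+

lemma expands_as_center: "expands_as f a b c R \<Longrightarrow> f a b = c 0 0"
  by (simp add: expands_as_def double_series_0_0)

lemma expands_as_flip:
  "expands_as f a b c R \<Longrightarrow> expands_as (\<lambda>y x. f x y) b a (transpose_coeff c) R"
  unfolding expands_as_def double_series_transpose converges_within_transpose by blast

lemma eventually_abs_diff_less:
  assumes "\<bar>x - a\<bar> < (R::real)"
  shows "\<forall>\<^sub>F x in nhds x. \<bar>x - a\<bar> < R"
proof -
  have "((\<lambda>x. \<bar>x - a\<bar>) \<longlongrightarrow> \<bar>x - a\<bar>) (nhds x)" by (intro tendsto_intros filterlim_ident)
  then show ?thesis by (rule order_tendstoD(2)) (rule assms)
qed

lemma expands_as_has_derivative1:
  assumes e: "expands_as f a b c R" and xy: "\<bar>x - a\<bar> < R" "\<bar>y - b\<bar> < R"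
  shows "((\<lambda>x. f x y) has_real_derivative double_series (diff_coeff1 c) (x - a) (y - b)) (at x)"
proof -
  have "((\<lambda>x. double_series c x (y - b)) has_real_derivative double_series (diff_coeff1 c) (x - a) (y - b)) (at (x - a))"
    using has_field_derivative_double_series1[OF expands_asD(2)[OF e], of "x - a" "y - b"] xy by simp
  then have "((\<lambda>x. double_series c (x - a) (y - b)) has_real_derivative
      double_series (diff_coeff1 c) (x - a) (y - b)) (at x)"
    using DERIV_shift[of "\<lambda>x. double_series c x (y - b)" _ x "- a"] by simp
  moreover have "\<forall>\<^sub>F x in nhds x. f x y = double_series c (x - a) (y - b)"
    using eventually_abs_diff_less[OF xy(1)] by eventually_elim (rule expands_asD(3)[OF e _ xy(2)])
  ultimately show ?thesis by (subst DERIV_cong_ev[OF refl _ refl])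
qed

lemma expands_as_partial1: "expands_as f a b c R \<Longrightarrow> expands_as (partial1 f) a b (diff_coeff1 c) R"
  using expands_as_has_derivative1[of f a b c R]
  by (auto simp: expands_as_def partial1_def has_real_derivative_iff_has_vector_derivative
      intro!: vector_derivative_at converges_within_diff_coeff1)

lemma expands_as_partial2: "expands_as f a b c R \<Longrightarrow> expands_as (partial2 f) a b (diff_coeff2 c) R"
  using expands_as_flip[OF expands_as_partial1[OF expands_as_flip[of f a b c R]]]
  by (simp add: diff_coeff1_transpose partial1_def partial2_def[abs_def])

lemma expands_as_deriv1:
  assumes e: "expands_as f a b c R" and xy: "\<bar>x - a\<bar> < R" "\<bar>y - b\<bar> < R"
  shows "((\<lambda>x. f x y) has_real_derivative partial1 f x y) (at x)"
  using expands_as_has_derivative1[OF e xy] expands_asD(3)[OF expands_as_partial1[OF e] xy] by simp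

lemma expands_as_deriv2:
  assumes e: "expands_as f a b c R" and xy: "\<bar>x - a\<bar> < R" "\<bar>y - b\<bar> < R"
  shows "(f x has_real_derivative partial2 f x y) (at y)"
  using expands_as_deriv1[OF expands_as_flip[OF e] xy(2,1)] by (simp add: partial1_def partial2_def)

text \<open>The coefficientwise derivatives in the two variables commute, hence so do the partial
  derivatives.\<close>

lemma expands_as_mixed:
  assumes e: "expands_as f a b c R" and xy: "\<bar>x - a\<bar> < R" "\<bar>y - b\<bar> < R"
  shows "partial1 (partial2 f) x y = partial2 (partial1 f) x y"
  using expands_asD(3)[OF expands_as_partial1[OF expands_as_partial2[OF e]] xy]
    expands_asD(3)[OF expands_as_partial2[OF expands_as_partial1[OF e]] xy]
  by (simp add: diff_coeff2_diff_coeff1)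

abbreviation box2 :: "real \<Rightarrow> real \<Rightarrow> real \<Rightarrow> (real \<times> real) set" where
  "box2 a b R \<equiv> {(x, y). \<bar>x - a\<bar> < R \<and> \<bar>y - b\<bar> < R}"

lemma open_box2: "open (box2 a b R)"
proof -
  have "box2 a b R = {a - R<..<a + R} \<times> {b - R<..<b + R}" by auto
  then show ?thesis by (simp add: open_Times)
qed

lemma expands_as_differentiable:
  assumes e: "expands_as f a b c R"
  shows "(\<lambda>(x, y). f x y) differentiable_on box2 a b R"
  unfolding differentiable_on_def
proof
  fix z assume z: "z \<in> box2 a b R"
  obtain x y where xy: "z = (x, y)" "\<bar>x - a\<bar> < R" "\<bar>y - b\<bar> < R" using z by auto
  define g where "g = (\<lambda>z :: real \<times> real. z - (a, b))"
  have g: "(g has_derivative (\<lambda>h. h)) (at z)" unfolding g_def by (auto intro!: derivative_eq_intros)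
  have "\<exists>F'. ((\<lambda>(u, v). double_series c u v) has_derivative F') (at (g z))"
    using has_derivative_double_series[OF expands_asD(2)[OF e] xy(2,3)] by (auto simp: g_def xy)
  then obtain F' where "((\<lambda>z. (\<lambda>(u, v). double_series c u v) (g z)) has_derivative F') (at z)"
    using has_derivative_compose[OF g] by blast
  then have "((\<lambda>(x, y). f x y) has_derivative F') (at z)"
    by (rule has_derivative_transform_within_open[OF _ open_box2 z])
       (use expands_asD(3)[OF e] in \<open>auto simp: g_def\<close>)
  then have "(\<lambda>(x, y). f x y) differentiable (at z)" unfolding differentiable_def by blast
  then show "(\<lambda>(x, y). f x y) differentiable (at z within box2 a b R)"
    by (rule differentiable_at_withinI)
qed

lemma expands_as_continuous:
  assumes e: "expands_as f a b c R"
  shows "continuous_on (box2 a b R) (\<lambda>(x, y). f x y)"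
  using expands_as_differentiable[OF e] by (rule differentiable_imp_continuous_on)

lemma expands_as_real_analytic:
  assumes e: "expands_as f a b c R"
  shows "real_analytic_on f (box2 a b R)"
  unfolding real_analytic_on_def
proof (intro ballI, clarify)
  fix x y assume xy: "\<bar>x - a\<bar> < R" "\<bar>y - b\<bar> < R"
  obtain c' where c': "\<forall>\<^sub>F (u, v) in nhds (x - a, y - b).
      ((\<lambda>(m, n). c' m n * (u - (x - a)) ^ m * (v - (y - b)) ^ n) has_sum double_series c u v) UNIV"
    using double_series_recenter[OF expands_asD(2)[OF e] xy] by blast
  have "((\<lambda>z. z - (a, b)) \<longlongrightarrow> (x, y) - (a, b)) (nhds (x, y))" by (intro tendsto_intros filterlim_ident)
  then have "\<forall>\<^sub>F z in nhds (x, y). (case z - (a, b) of (u, v) \<Rightarrow>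
      ((\<lambda>(m, n). c' m n * (u - (x - a)) ^ m * (v - (y - b)) ^ n) has_sum double_series c u v) UNIV)"
    using c' by (simp add: filterlim_iff)
  moreover have "\<forall>\<^sub>F z in nhds (x, y). z \<in> box2 a b R"
    by (rule eventually_nhds_in_open[OF open_box2]) (use xy in auto)
  ultimately have "\<forall>\<^sub>F (u, v) in nhds (x, y).
      ((\<lambda>(m, n). c' m n * (u - x) ^ m * (v - y) ^ n) has_sum f u v) UNIV"
    by eventually_elim (use expands_asD(3)[OF e] in auto)
  then show "\<exists>c. \<forall>\<^sub>F (u, v) in nhds (x, y). ((\<lambda>(m, n). c m n * (u - x) ^ m * (v - y) ^ n) has_sum f u v) UNIV"
    by blast
qed

text \<open>Convergence at the single corner \<open>(a + R, b + R)\<close> of a small square already bounds the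
  coefficients well enough to give absolute convergence on its interior.\<close>

lemma real_analytic_expands_as:
  assumes f: "real_analytic_on f D" and D: "open D" "(a, b) \<in> D"
  obtains c R where "expands_as f a b c R" "box2 a b R \<subseteq> D"
proof -
  obtain c where c: "\<forall>\<^sub>F (x, y) in nhds (a, b).
      ((\<lambda>(m, n). c m n * (x - a) ^ m * (y - b) ^ n) has_sum f x y) UNIV"
    using f D(2) by (auto simp: real_analytic_on_def)
  have "\<forall>\<^sub>F z in nhds (a, b). z \<in> D \<and> (case z of (x, y) \<Rightarrow>
      ((\<lambda>(m, n). c m n * (x - a) ^ m * (y - b) ^ n) has_sum f x y) UNIV)"
    using c eventually_nhds_in_open[OF D] by eventually_elim auto
  then obtain \<epsilon> where \<epsilon>: "\<epsilon> > 0" "\<And>x y. dist (x, y) (a, b) < \<epsilon> \<Longrightarrow> (x, y) \<in> D \<and>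
      ((\<lambda>(m, n). c m n * (x - a) ^ m * (y - b) ^ n) has_sum f x y) UNIV"
    unfolding eventually_nhds_metric by auto
  define R where "R = \<epsilon> / 3"
  have R: "R > 0" using \<epsilon> by (simp add: R_def)
  have box: "(x, y) \<in> D \<and> ((\<lambda>(m, n). c m n * (x - a) ^ m * (y - b) ^ n) has_sum f x y) UNIV"
    if "\<bar>x - a\<bar> \<le> R" "\<bar>y - b\<bar> \<le> R" for x y
  proof (rule \<epsilon>(2))
    have "dist (x, y) (a, b) \<le> \<bar>x - a\<bar> + \<bar>y - b\<bar>"
      using norm_Pair_le[of "x - a" "y - b"] by (simp add: dist_norm)
    then show "dist (x, y) (a, b) < \<epsilon>" using that \<epsilon> by (simp add: R_def)
  qed
  have "(\<lambda>(m, n). c m n * R ^ m * R ^ n) summable_on UNIV"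
    using box[of "a + R" "b + R"] R by (auto simp: summable_on_def)
  then have "(\<lambda>p. norm (case p of (m, n) \<Rightarrow> c m n * R ^ m * R ^ n)) summable_on UNIV"
    by (subst (asm) summable_on_iff_abs_summable_on_real)
  then have "converges_within c R"
    by (rule converges_withinI_summable) (use R in auto)
  then have "expands_as f a b c R"
    using box R by (auto simp: expands_as_def double_series_def intro!: infsumI[symmetric])
  moreover have "box2 a b R \<subseteq> D" using box by force
  ultimately show ?thesis by (rule that)
qed

text \<open>The unit normal must exist on an open set around the point. The subset of the square on which
  \<open>1 - h\<^sub>u\<^sup>2 + h\<^sub>v\<^sup>2\<close> is positive serves.\<close>

lemma expands_as_lorentz_graph:
  assumes e: "expands_as h a b c R" and uv: "(u, v) \<in> box2 a b R"
    and W: "1 - (partial1 h u v)\<^sup>2 + (partial2 h u v)\<^sup>2 > 0"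
  shows "timelike_at (graph_surface h) u v"
    and "has_gauss_curvature lorentz (graph_surface h) u v
      (- (partial1 (partial1 h) u v * partial2 (partial2 h) u v - (partial2 (partial1 h) u v)\<^sup>2)
        / (1 - (partial1 h u v)\<^sup>2 + (partial2 h u v)\<^sup>2)\<^sup>2)"
proof -
  let ?W = "\<lambda>(u, v). 1 - (partial1 h u v)\<^sup>2 + (partial2 h u v)\<^sup>2"
  note e1 = expands_as_partial1[OF e] and e2 = expands_as_partial2[OF e]
  define \<Omega> where "\<Omega> = {z \<in> box2 a b R. 0 < ?W z}"
  have "continuous_on (box2 a b R) ?W"
    using expands_as_continuous[OF e1] expands_as_continuous[OF e2]
    unfolding case_prod_unfold by (intro continuous_intros)
  then have "open (box2 a b R \<inter> ?W -` {0<..})"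
    by (rule continuous_open_preimage[OF _ open_box2 open_greaterThan])
  moreover have "box2 a b R \<inter> ?W -` {0<..} = \<Omega>" by (auto simp: \<Omega>_def)
  ultimately have "open \<Omega>" by simp
  moreover have "(u, v) \<in> \<Omega>" using uv W by (simp add: \<Omega>_def)
  ultimately have \<Omega>: "open \<Omega>" "(u, v) \<in> \<Omega>" .
  have sub: "\<Omega> \<subseteq> box2 a b R" by (auto simp: \<Omega>_def)
  have uv': "\<bar>u - a\<bar> < R" "\<bar>v - b\<bar> < R" using uv by auto
  show "timelike_at (graph_surface h) u v"
    by (rule timelike_at_graph[OF expands_as_deriv1[OF e uv'] expands_as_deriv2[OF e uv'] W])
  show "has_gauss_curvature lorentz (graph_surface h) u v
      (- (partial1 (partial1 h) u v * partial2 (partial2 h) u v - (partial2 (partial1 h) u v)\<^sup>2)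
        / (1 - (partial1 h u v)\<^sup>2 + (partial2 h u v)\<^sup>2)\<^sup>2)"
  proof (rule graph_has_gauss_curvature[OF \<Omega>])
    show "((\<lambda>x. h x y) has_real_derivative partial1 h x y) (at x)"
      "(h x has_real_derivative partial2 h x y) (at y)" if "(x, y) \<in> \<Omega>" for x y
      using that sub by (auto intro!: expands_as_deriv1[OF e] expands_as_deriv2[OF e])
    show "(\<lambda>(a, b). partial1 h a b) differentiable_on \<Omega>"
      "(\<lambda>(a, b). partial2 h a b) differentiable_on \<Omega>"
      using expands_as_differentiable[OF e1] expands_as_differentiable[OF e2] sub
      by (blast intro: differentiable_on_subset)+
    show "0 < 1 - (partial1 h x y)\<^sup>2 + (partial2 h x y)\<^sup>2" if "(x, y) \<in> \<Omega>" for x y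
      using that by (auto simp: \<Omega>_def)
    show "((\<lambda>x. partial2 h x v) has_real_derivative partial2 (partial1 h) u v) (at u)"
      using expands_as_deriv1[OF e2 uv'] by (simp add: expands_as_mixed[OF e uv'])
  qed (use uv' in \<open>auto intro!: expands_as_deriv1[OF e1] expands_as_deriv2[OF e1] expands_as_deriv2[OF e2]\<close>)
qed

lemma expands_as_umbilic:
  assumes e: "expands_as f a b c R"
    and flat: "partial1 (partial1 f) a b = 0" "partial2 (partial1 f) a b = 0" "partial2 (partial2 f) a b = 0"
  shows "umbilic_at inner (graph_surface f) a b"
proof (rule graph_umbilic_if_flat[OF open_box2])
  note e1 = expands_as_partial1[OF e] and e2 = expands_as_partial2[OF e]
  have R: "\<bar>a - a\<bar> < R" "\<bar>b - b\<bar> < R" using expands_asD(1)[OF e] by auto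
  show "(a, b) \<in> box2 a b R" using R by auto
  show "((\<lambda>x. f x y) has_real_derivative partial1 f x y) (at x)"
    "(f x has_real_derivative partial2 f x y) (at y)" if "(x, y) \<in> box2 a b R" for x y
    using that by (auto intro!: expands_as_deriv1[OF e] expands_as_deriv2[OF e])
  show "(\<lambda>(a, b). partial1 f a b) differentiable_on box2 a b R"
    "(\<lambda>(a, b). partial2 f a b) differentiable_on box2 a b R"
    using expands_as_differentiable[OF e1] expands_as_differentiable[OF e2] by auto
  show "((\<lambda>x. partial1 f x b) has_real_derivative 0) (at a)" "(partial1 f a has_real_derivative 0) (at b)"
    "((\<lambda>x. partial2 f x b) has_real_derivative 0) (at a)" "(partial2 f a has_real_derivative 0) (at b)"
    using expands_as_deriv1[OF e1 R] expands_as_deriv2[OF e1 R] expands_as_deriv1[OF e2 R] expands_as_deriv2[OF e2 R]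
    by (simp_all add: flat expands_as_mixed[OF e R])
qed

section \<open>Complexification and rotation of the second variable\<close>

definition complex_coeff :: "(nat \<Rightarrow> nat \<Rightarrow> real) \<Rightarrow> nat \<Rightarrow> nat \<Rightarrow> complex" where
  "complex_coeff c m n = complex_of_real (c m n)"

lemma converges_within_complex_coeff:
  "converges_within c R \<Longrightarrow> converges_within (complex_coeff c) R"
  by (simp add: converges_within_def complex_coeff_def)

lemma diff_coeff_complex_coeff:
  "diff_coeff1 (complex_coeff c) = complex_coeff (diff_coeff1 c)"
  "diff_coeff2 (complex_coeff c) = complex_coeff (diff_coeff2 c)"
  by (simp_all add: complex_coeff_def diff_coeff1_def diff_coeff2_def fun_eq_iff)

lemma double_series_complex_coeff:
  assumes "converges_within c R" "\<bar>u\<bar> < R" "\<bar>v\<bar> < R"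
  shows "double_series (complex_coeff c) (complex_of_real u) (complex_of_real v) = complex_of_real (double_series c u v)"
proof -
  have "((\<lambda>(m, n). c m n * u ^ m * v ^ n) has_sum double_series c u v) UNIV"
    using has_sum_double_series[of c R u v] assms by simp
  from has_sum_of_real[OF this]
  show ?thesis unfolding double_series_def complex_coeff_def
    by (intro infsumI) (simp add: case_prod_unfold)
qed

text \<open>For fixed real \<open>x\<close>, the left-hand side of the minimal surface equation is a holomorphic function
  of the second variable on a disc. It vanishes on the real diameter, hence everywhere by the
  identity theorem.\<close>

lemma minimal_surface_eq_complexified:
  assumes e: "expands_as f a 0 c R"
    and min: "\<And>x y. (x, y) \<in> box2 a 0 R \<Longrightarrow> minimal_surface_eq f x y"
    and x: "\<bar>x - a\<bar> < R" and z: "norm z < R"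
  defines "F \<equiv> \<lambda>c. double_series (complex_coeff c) (complex_of_real (x - a))"
  shows "(1 + (F (diff_coeff2 c) z)\<^sup>2) * F (diff_coeff1 (diff_coeff1 c)) z
    - 2 * F (diff_coeff1 c) z * F (diff_coeff2 c) z * F (diff_coeff2 (diff_coeff1 c)) z
    + (1 + (F (diff_coeff1 c) z)\<^sup>2) * F (diff_coeff2 (diff_coeff2 c)) z = 0"
proof -
  define G where "G z = (1 + (F (diff_coeff2 c) z)\<^sup>2) * F (diff_coeff1 (diff_coeff1 c)) z
    - 2 * F (diff_coeff1 c) z * F (diff_coeff2 c) z * F (diff_coeff2 (diff_coeff1 c)) z
    + (1 + (F (diff_coeff1 c) z)\<^sup>2) * F (diff_coeff2 (diff_coeff2 c)) z" for z
  note conv = expands_asD(2)[OF e] and R = expands_asD(1)[OF e]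
  have "F b holomorphic_on ball 0 R" if "converges_within b R" for b
    unfolding holomorphic_on_def F_def
  proof
    fix z :: complex assume "z \<in> ball 0 R"
    then have "(double_series (complex_coeff b) (complex_of_real (x - a)) has_field_derivative
        double_series (diff_coeff2 (complex_coeff b)) (complex_of_real (x - a)) z) (at z)"
      using x by (intro has_field_derivative_double_series2[OF converges_within_complex_coeff[OF that]])
        (simp_all add: norm_of_real del: of_real_diff)
    then have "double_series (complex_coeff b) (complex_of_real (x - a)) field_differentiable at z"
      unfolding field_differentiable_def by blast
    then show "double_series (complex_coeff b) (complex_of_real (x - a)) field_differentiable at z within ball 0 R"
      by (rule field_differentiable_at_within)
  qed
  then have hol: "G holomorphic_on ball 0 R"
    unfolding G_def by (intro holomorphic_intros) (auto intro!: converges_within_diff_coeff1 converges_within_diff_coeff2 conv)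
  have real: "G (complex_of_real y) = 0" if y: "\<bar>y\<bar> < R" for y
  proof -
    have F: "F b (complex_of_real y) = complex_of_real (g x y)" if "expands_as g a 0 b R" for b g
      using double_series_complex_coeff[OF expands_asD(2)[OF that] x y] expands_asD(3)[OF that x, of y] y
      by (simp add: F_def)
    note e1 = expands_as_partial1[OF e] and e2 = expands_as_partial2[OF e]
    have "G (complex_of_real y) = complex_of_real
       ((1 + (partial2 f x y)\<^sup>2) * partial1 (partial1 f) x y
         - 2 * partial1 f x y * partial2 f x y * partial2 (partial1 f) x y
         + (1 + (partial1 f x y)\<^sup>2) * partial2 (partial2 f) x y)"
      by (simp add: G_def F[OF e1] F[OF e2] F[OF expands_as_partial1[OF e1]]
          F[OF expands_as_partial2[OF e1]] F[OF expands_as_partial2[OF e2]])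
    also have "\<dots> = 0"
      using min[of x y] x y by (simp only: minimal_surface_eq_def) simp
    finally show ?thesis .
  qed
  have "G z = 0"
  proof (rule analytic_continuation[OF hol, where U = "complex_of_real ` {-R<..<R}" and \<xi> = 0])
    have "0 islimpt ({-R<..<R} :: real set)"
      using R by (intro interior_limit_point) auto
    then obtain s :: "nat \<Rightarrow> real" where s: "\<And>n. s n \<in> {-R<..<R} - {0}" "s \<longlonglongrightarrow> 0"
      unfolding islimpt_sequential by blast
    have "(\<lambda>n. complex_of_real (s n)) \<longlonglongrightarrow> complex_of_real 0" by (rule tendsto_of_real[OF s(2)])
    moreover have "complex_of_real (s n) \<in> complex_of_real ` {-R<..<R} - {0}" for n using s(1)[of n] by auto
    ultimately show "(0::complex) islimpt complex_of_real ` {-R<..<R}"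
      unfolding islimpt_sequential by (intro exI[of _ "\<lambda>n. complex_of_real (s n)"]) simp
  qed (use R z real in \<open>auto simp: abs_less_iff\<close>)
  then show ?thesis unfolding G_def .
qed

text \<open>The relation expresses that \<open>g x y = \<mu> * f x (\<i> * y)\<close> on the level of coefficients: \<open>c\<close> are those of
  \<open>f\<close>, and the real numbers \<open>d\<close> are those of \<open>g\<close>. It is preserved by differentiation, where each
  derivative in the second variable contributes a factor \<open>\<i>\<close>.\<close>

definition rotated_coeff :: "complex \<Rightarrow> (nat \<Rightarrow> nat \<Rightarrow> real) \<Rightarrow> (nat \<Rightarrow> nat \<Rightarrow> real) \<Rightarrow> bool" where
  "rotated_coeff \<mu> c d \<longleftrightarrow> (\<forall>m n. complex_of_real (d m n) = \<mu> * \<i> ^ n * complex_of_real (c m n))"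

lemma rotated_coeff_diff_coeff1:
  "rotated_coeff \<mu> c d \<Longrightarrow> rotated_coeff \<mu> (diff_coeff1 c) (diff_coeff1 d)"
  by (simp add: rotated_coeff_def diff_coeff1_def)

lemma rotated_coeff_diff_coeff2:
  "rotated_coeff \<mu> c d \<Longrightarrow> rotated_coeff (\<mu> * \<i>) (diff_coeff2 c) (diff_coeff2 d)"
  by (simp add: rotated_coeff_def diff_coeff2_def)

lemma double_series_rotated:
  assumes c: "converges_within c R" and rot: "rotated_coeff \<mu> c d" and xy: "\<bar>x\<bar> < R" "\<bar>y\<bar> < R"
  shows "complex_of_real (double_series d x y)
    = \<mu> * double_series (complex_coeff c) (complex_of_real x) (\<i> * complex_of_real y)"
proof -
  have "((\<lambda>(m, n). complex_coeff c m n * complex_of_real x ^ m * (\<i> * complex_of_real y) ^ n) has_sum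
      double_series (complex_coeff c) (complex_of_real x) (\<i> * complex_of_real y)) UNIV"
    by (rule has_sum_double_series[OF converges_within_complex_coeff[OF c]]) (use xy in \<open>auto simp: norm_mult\<close>)
  from has_sum_cmult_right[OF this, of \<mu>]
  have "((\<lambda>(m, n). complex_of_real (d m n * x ^ m * y ^ n)) has_sum
      \<mu> * double_series (complex_coeff c) (complex_of_real x) (\<i> * complex_of_real y)) UNIV"
    using rot by (simp add: rotated_coeff_def complex_coeff_def case_prod_unfold power_mult_distrib mult_ac)
  then have S: "((\<lambda>p. complex_of_real (case p of (m, n) \<Rightarrow> d m n * x ^ m * y ^ n)) has_sum
      \<mu> * double_series (complex_coeff c) (complex_of_real x) (\<i> * complex_of_real y)) UNIV" (is "(_ has_sum ?S) UNIV")
    by (simp add: case_prod_unfold)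
  from has_sum_Re[OF this] have R: "((\<lambda>(m, n). d m n * x ^ m * y ^ n) has_sum Re ?S) UNIV" by simp
  then have "double_series d x y = Re ?S" unfolding double_series_def by (rule infsumI)
  moreover have "?S = complex_of_real (Re ?S)"
    by (rule has_sum_unique[OF S has_sum_of_real[OF R]])
  ultimately show ?thesis by simp
qed

lemma converges_within_rotated:
  assumes "converges_within c R" "rotated_coeff \<mu> c d" "norm \<mu> = 1"
  shows "converges_within d R"
proof -
  have "\<bar>d m n\<bar> = \<bar>c m n\<bar>" for m n
  proof -
    have "norm (complex_of_real (d m n)) = norm (\<mu> * \<i> ^ n * complex_of_real (c m n))"
      using assms(2) by (simp add: rotated_coeff_def)
    then show ?thesis by (simp add: norm_mult norm_power assms(3))
  qed
  then show ?thesis using assms(1) by (simp add: converges_within_def)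
qed

lemma expands_as_rotated:
  assumes c: "converges_within c R" and rot: "rotated_coeff \<mu> c d" and g: "expands_as g a 0 d R"
    and xy: "\<bar>x - a\<bar> < R" "\<bar>y\<bar> < R"
  shows "complex_of_real (g x y)
    = \<mu> * double_series (complex_coeff c) (complex_of_real (x - a)) (\<i> * complex_of_real y)"
  using double_series_rotated[OF c rot xy] expands_asD(3)[OF g, of x y] xy by simp

text \<open>The complexified minimal surface equation is evaluated at \<open>z = \<i> * y\<close>. By the chain rule the
  derivatives of \<open>g\<close> are those of \<open>f\<close> times \<open>\<mu>\<close>, with a further factor \<open>\<i>\<close> for each
  derivative in \<open>y\<close>, and the equation becomes the one below after multiplication by \<open>\<mu> ^ 3\<close>. For
  \<open>\<mu> = 1\<close>, where \<open>\<epsilon> = 1\<close>, this is the Born-Infeld equation with time \<open>y\<close>; for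
  \<open>\<mu> = - \<i>\<close>, where \<open>\<epsilon> = -1\<close>, it is the one with time \<open>x\<close>.\<close>

lemma wick_rotation_pde:
  assumes e: "expands_as f a 0 c R" and g: "expands_as g a 0 d R" and rot: "rotated_coeff \<mu> c d"
    and min: "\<And>x y. (x, y) \<in> box2 a 0 R \<Longrightarrow> minimal_surface_eq f x y"
    and xy: "(x, y) \<in> box2 a 0 R"
    and \<mu>: "\<mu> * \<mu> = complex_of_real \<epsilon>" "\<epsilon> * \<epsilon> = 1"
  shows "(\<epsilon> - (partial2 g x y)\<^sup>2) * partial1 (partial1 g) x y
     + 2 * partial1 g x y * partial2 g x y * partial2 (partial1 g) x y
     - (\<epsilon> + (partial1 g x y)\<^sup>2) * partial2 (partial2 g) x y = 0"
proof -
  define F where "F = (\<lambda>c. double_series (complex_coeff c) (complex_of_real (x - a)))"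
  define z where "z = \<i> * complex_of_real y"
  have xy': "\<bar>x - a\<bar> < R" "\<bar>y\<bar> < R" using xy by auto
  note c = expands_asD(2)[OF e]
  note c1 = converges_within_diff_coeff1[OF c] and c2 = converges_within_diff_coeff2[OF c]
  note r1 = rotated_coeff_diff_coeff1[OF rot] and r2 = rotated_coeff_diff_coeff2[OF rot]
  note g1 = expands_as_partial1[OF g] and g2 = expands_as_partial2[OF g]
  have min': "(1 + (F (diff_coeff2 c) z)\<^sup>2) * F (diff_coeff1 (diff_coeff1 c)) z
    - 2 * F (diff_coeff1 c) z * F (diff_coeff2 c) z * F (diff_coeff2 (diff_coeff1 c)) z
    + (1 + (F (diff_coeff1 c) z)\<^sup>2) * F (diff_coeff2 (diff_coeff2 c)) z = 0"
    unfolding F_def by (rule minimal_surface_eq_complexified[OF e min xy'(1)]) (use xy' in \<open>auto simp: z_def norm_mult\<close>)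
  have p: "complex_of_real (partial1 g x y) = \<mu> * F (diff_coeff1 c) z"
      "complex_of_real (partial2 g x y) = \<mu> * \<i> * F (diff_coeff2 c) z"
      "complex_of_real (partial1 (partial1 g) x y) = \<mu> * F (diff_coeff1 (diff_coeff1 c)) z"
      "complex_of_real (partial2 (partial1 g) x y) = \<mu> * \<i> * F (diff_coeff2 (diff_coeff1 c)) z"
      "complex_of_real (partial2 (partial2 g) x y) = - \<mu> * F (diff_coeff2 (diff_coeff2 c)) z"
    unfolding F_def z_def
    using expands_as_rotated[OF c1 r1 g1 xy'] expands_as_rotated[OF c2 r2 g2 xy']
      expands_as_rotated[OF converges_within_diff_coeff1[OF c1] rotated_coeff_diff_coeff1[OF r1] expands_as_partial1[OF g1] xy']
      expands_as_rotated[OF converges_within_diff_coeff2[OF c1] rotated_coeff_diff_coeff2[OF r1] expands_as_partial2[OF g1] xy']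
      expands_as_rotated[OF converges_within_diff_coeff2[OF c2] rotated_coeff_diff_coeff2[OF r2] expands_as_partial2[OF g2] xy']
    by (simp_all add: mult.assoc)
  have alg: "(\<mu> * \<mu> - (\<mu> * \<i> * q)\<^sup>2) * (\<mu> * r) + 2 * (\<mu> * p) * (\<mu> * \<i> * q) * (\<mu> * \<i> * s)
      - (\<mu> * \<mu> + (\<mu> * p)\<^sup>2) * (- \<mu> * t)
    = \<mu> * \<mu> * \<mu> * ((1 + q\<^sup>2) * r - 2 * p * q * s + (1 + p\<^sup>2) * t)" for p q r s t
    by (simp add: power2_eq_square algebra_simps)
  have "complex_of_real ((\<epsilon> - (partial2 g x y)\<^sup>2) * partial1 (partial1 g) x y
     + 2 * partial1 g x y * partial2 g x y * partial2 (partial1 g) x y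
     - (\<epsilon> + (partial1 g x y)\<^sup>2) * partial2 (partial2 g) x y) = 0"
    unfolding of_real_add of_real_diff of_real_mult of_real_power of_real_numeral p \<mu>(1)[symmetric] alg min' by simp
  then show ?thesis by (simp only: of_real_eq_0_iff)
qed

lemma expands_as_iterated_partial2:
  "expands_as f a b c R \<Longrightarrow> expands_as ((partial2 ^^ n) f) a b ((diff_coeff2 ^^ n) c) R"
  by (induction n) (auto intro: expands_as_partial2)

lemma iterated_diff_coeff2:
  "(diff_coeff2 ^^ n) c m k * fact k = fact (n + k) * (c m (n + k) :: real)"
proof (induction n arbitrary: k)
  case (Suc n)
  have "(diff_coeff2 ^^ Suc n) c m k * fact k = (diff_coeff2 ^^ n) c m (Suc k) * fact (Suc k)"
    by (simp add: diff_coeff2_def algebra_simps)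
  then show ?case by (simp only: Suc) simp
qed simp

text \<open>The Taylor coefficients in \<open>y\<close> at \<open>y = 0\<close> are the column sums of the double series, since
  only the column \<open>n\<close> survives in the \<open>n\<close>-th derivative at \<open>y = 0\<close>.\<close>

lemma taylor_coefficient_sums:
  assumes e: "expands_as f a 0 c R" and x: "\<bar>x - a\<bar> < R"
  shows "(\<lambda>m. c m n * (x - a) ^ m) sums ((partial2 ^^ n) f x 0 / fact n)"
proof -
  note e' = expands_as_iterated_partial2[OF e, of n]
  have "(\<lambda>m. (\<Sum>k. (diff_coeff2 ^^ n) c m k * 0 ^ k) * (x - a) ^ m) sums (partial2 ^^ n) f x 0"
    using double_series_rows[OF expands_asD(2)[OF e'], of "x - a" 0] expands_asD(3)[OF e' x, of 0] x expands_asD(1)[OF e]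
    by simp
  moreover have "(diff_coeff2 ^^ n) c m 0 = fact n * c m n" for m
    using iterated_diff_coeff2[of n c m 0] by simp
  ultimately have "(\<lambda>m. fact n * c m n * (x - a) ^ m) sums (partial2 ^^ n) f x 0"
    by (simp only: powser_zero)
  from sums_divide[OF this, of "fact n"] show ?thesis by simp
qed

lemma taylor_term_sums:
  assumes e: "expands_as f a 0 c R" and x: "\<bar>x - a\<bar> < R" and z: "norm z < R"
  shows "taylor_term f x z sums double_series (complex_coeff c) (complex_of_real (x - a)) z"
proof -
  have "(\<lambda>n. (\<Sum>m. transpose_coeff (complex_coeff c) n m * complex_of_real (x - a) ^ m) * z ^ n) sums
      double_series (complex_coeff c) (complex_of_real (x - a)) z"
    using double_series_rows[of "transpose_coeff (complex_coeff c)" R z "complex_of_real (x - a)"]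
      converges_within_complex_coeff[OF expands_asD(2)[OF e]] x z
    by (simp add: double_series_transpose norm_of_real del: of_real_diff)
  moreover have "(\<Sum>m. transpose_coeff (complex_coeff c) n m * complex_of_real (x - a) ^ m)
      = complex_of_real ((partial2 ^^ n) f x 0 / fact n)" for n
    using sums_unique[OF sums_of_real[OF taylor_coefficient_sums[OF e x, of n], where 'a = complex]]
    by (simp add: transpose_coeff_def complex_coeff_def)
  ultimately show ?thesis by (simp add: taylor_term_def[abs_def])
qed

text \<open>Averaging the expansions of \<open>f x y\<close> and \<open>\<epsilon> * f x (- y)\<close> removes all powers of \<open>y\<close> of the wrong
  parity while still representing \<open>f\<close>.\<close>

lemma expands_as_symmetric:
  assumes e: "expands_as f a 0 c R"
    and sym: "\<And>x y. (x, y) \<in> box2 a 0 R \<Longrightarrow> f x (- y) = \<epsilon> * f x y" and \<epsilon>: "\<epsilon> = 1 \<or> \<epsilon> = -1"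
  obtains c' where "expands_as f a 0 c' R" "\<And>m n. (-1) ^ n \<noteq> \<epsilon> \<Longrightarrow> c' m n = 0"
proof
  define c' where "c' m n = (1 + \<epsilon> * (-1) ^ n) / 2 * c m n" for m n
  note conv = expands_asD(2)[OF e]
  have val: "c' m n = (if (-1) ^ n = \<epsilon> then c m n else 0)" for m n
    using \<epsilon> by (cases "even n") (auto simp: c'_def)
  then show "c' m n = 0" if "(-1) ^ n \<noteq> \<epsilon>" for m n using that by simp
  have "converges_within c' R"
    unfolding converges_within_def
  proof (intro allI impI, elim conjE)
    fix \<rho> assume \<rho>: "0 \<le> \<rho>" "\<rho> < R"
    then have "(\<lambda>(m, n). norm (c m n) * \<rho> ^ (m + n)) summable_on UNIV"
      using conv by (auto simp: converges_within_def)
    then show "(\<lambda>(m, n). norm (c' m n) * \<rho> ^ (m + n)) summable_on UNIV"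
      by (rule summable_on_comparison_test) (use \<rho> in \<open>auto simp: val\<close>)
  qed
  moreover have "f x y = double_series c' (x - a) (y - 0)" if xy: "\<bar>x - a\<bar> < R" "\<bar>y - 0\<bar> < R" for x y
  proof -
    have s: "((\<lambda>(m, n). c m n * (x - a) ^ m * w ^ n) has_sum f x w) UNIV" if "\<bar>w\<bar> < R" for w
      using has_sum_double_series[OF conv, of "x - a" w] expands_asD(3)[OF e xy(1), of w] that xy by simp
    have "((\<lambda>p. (case p of (m, n) \<Rightarrow> c m n * (x - a) ^ m * y ^ n) / 2
        + \<epsilon> / 2 * (case p of (m, n) \<Rightarrow> c m n * (x - a) ^ m * (- y) ^ n)) has_sum (f x y / 2 + \<epsilon> / 2 * f x (- y))) UNIV"
      unfolding divide_inverse using xy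
      by (intro has_sum_add has_sum_cmult_left has_sum_cmult_right s) auto
    moreover have "f x y / 2 + \<epsilon> / 2 * f x (- y) = f x y" using sym[of x y] xy \<epsilon> by auto
    moreover have "(\<lambda>p. (case p of (m, n) \<Rightarrow> c m n * (x - a) ^ m * y ^ n) / 2
        + \<epsilon> / 2 * (case p of (m, n) \<Rightarrow> c m n * (x - a) ^ m * (- y) ^ n))
      = (\<lambda>(m, n). c' m n * (x - a) ^ m * y ^ n)"
      by (auto simp: c'_def fun_eq_iff power_minus[of y] field_simps)
    ultimately show ?thesis unfolding double_series_def by (simp add: infsumI)
  qed
  ultimately show "expands_as f a 0 c' R" using expands_asD(1)[OF e] by (simp add: expands_as_def)
qed

lemma rotated_coeff_exists:
  assumes "\<And>m n. c m n \<noteq> 0 \<Longrightarrow> \<mu> * \<i> ^ n \<in> \<real>"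
  obtains d where "rotated_coeff \<mu> c d"
proof
  show "rotated_coeff \<mu> c (\<lambda>m n. Re (\<mu> * \<i> ^ n) * c m n)"
    unfolding rotated_coeff_def
  proof (intro allI)
    fix m n
    have "complex_of_real (Re (\<mu> * \<i> ^ n)) = \<mu> * \<i> ^ n" if "c m n \<noteq> 0"
      using assms[OF that] by (rule of_real_Re)
    then show "complex_of_real (Re (\<mu> * \<i> ^ n) * c m n) = \<mu> * \<i> ^ n * complex_of_real (c m n)"
      by (cases "c m n = 0") (simp_all only: of_real_mult of_real_0 mult_zero_right not_False_eq_True simp_thms)
  qed
qed

text \<open>Substituting \<open>\<i> * y\<close> into the Taylor expansion of \<open>f\<close> and multiplying by \<open>\<mu>\<close> gives a
  real-valued function with the rotated coefficients, which is therefore itself analytic near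
  \<open>(a, 0)\<close>.\<close>

lemma wick_rotation_expansion:
  assumes e: "expands_as f a 0 c R" and rot: "rotated_coeff \<mu> c d" and \<mu>: "norm \<mu> = 1"
  defines "g \<equiv> \<lambda>x y. Re (\<mu> * taylor_subst f x (\<i> * complex_of_real y))"
  shows "expands_as g a 0 d R"
    and "(x, y) \<in> box2 a 0 R \<Longrightarrow> summable (taylor_term f x (\<i> * complex_of_real y))"
    and "(x, y) \<in> box2 a 0 R \<Longrightarrow> complex_of_real (g x y) = \<mu> * taylor_subst f x (\<i> * complex_of_real y)"
proof -
  have t: "taylor_term f x (\<i> * complex_of_real y) sums
      double_series (complex_coeff c) (complex_of_real (x - a)) (\<i> * complex_of_real y)"
    if "\<bar>x - a\<bar> < R" "\<bar>y\<bar> < R" for x y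
    by (rule taylor_term_sums[OF e]) (use that in \<open>auto simp: norm_mult\<close>)
  have d: "complex_of_real (double_series d (x - a) y) = \<mu> * taylor_subst f x (\<i> * complex_of_real y)"
    if "\<bar>x - a\<bar> < R" "\<bar>y\<bar> < R" for x y
    using double_series_rotated[OF expands_asD(2)[OF e] rot that] sums_unique[OF t[OF that]]
    by (simp add: taylor_subst_def)
  have g: "g x y = double_series d (x - a) y" if "\<bar>x - a\<bar> < R" "\<bar>y\<bar> < R" for x y
    unfolding g_def d[OF that, symmetric] by simp
  then show "expands_as g a 0 d R"
    using expands_asD(1)[OF e] converges_within_rotated[OF expands_asD(2)[OF e] rot \<mu>]
    by (simp add: expands_as_def)
  show "summable (taylor_term f x (\<i> * complex_of_real y))" if "(x, y) \<in> box2 a 0 R"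
    using t[of x y] that by (auto simp: sums_iff)
  show "complex_of_real (g x y) = \<mu> * taylor_subst f x (\<i> * complex_of_real y)" if "(x, y) \<in> box2 a 0 R"
    using g[of x y] d[of x y] that by auto
qed

lemma expands_as_center_partials:
  assumes e: "expands_as f a b c R"
  shows "partial1 f a b = c (Suc 0) 0" "partial2 f a b = c 0 (Suc 0)"
    "partial1 (partial1 f) a b = 2 * c 2 0" "partial2 (partial1 f) a b = c (Suc 0) (Suc 0)"
    "partial2 (partial2 f) a b = 2 * c 0 2"
  using expands_as_center[OF expands_as_partial1[OF e]] expands_as_center[OF expands_as_partial2[OF e]]
    expands_as_center[OF expands_as_partial1[OF expands_as_partial1[OF e]]]
    expands_as_center[OF expands_as_partial2[OF expands_as_partial1[OF e]]]
    expands_as_center[OF expands_as_partial2[OF expands_as_partial2[OF e]]]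
  by (simp_all add: diff_coeff1_def diff_coeff2_def numeral_2_eq_2)

text \<open>Being timelike with curvature of a given sign is an open condition: \<open>K\<close> equals minus the
  Hessian determinant divided by the square of \<open>1 - h\<^sub>u\<^sup>2 + h\<^sub>v\<^sup>2\<close>, so both requirements are strict
  inequalities between continuous functions and need to be checked only at the center.\<close>

lemma expands_as_lorentz_graph_eventually:
  assumes e: "expands_as h a b c R"
    and W: "1 - (partial1 h a b)\<^sup>2 + (partial2 h a b)\<^sup>2 > 0"
    and \<Delta>: "\<sigma> * (partial1 (partial1 h) a b * partial2 (partial2 h) a b - (partial2 (partial1 h) a b)\<^sup>2) > 0"
  shows "\<forall>\<^sub>F (u, v) in nhds (a, b). (u, v) \<in> box2 a b R \<and> real_analytic_on h {(u, v)} \<and>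
    timelike_at (graph_surface h) u v \<and>
    (\<exists>K. \<sigma> * K < 0 \<and> has_gauss_curvature lorentz (graph_surface h) u v K)"
proof -
  let ?W = "\<lambda>z. 1 - (partial1 h (fst z) (snd z))\<^sup>2 + (partial2 h (fst z) (snd z))\<^sup>2"
  let ?\<Delta> = "\<lambda>z. \<sigma> * (partial1 (partial1 h) (fst z) (snd z) * partial2 (partial2 h) (fst z) (snd z)
     - (partial2 (partial1 h) (fst z) (snd z))\<^sup>2)"
  have ab: "(a, b) \<in> box2 a b R" using expands_asD(1)[OF e] by simp
  note e1 = expands_as_partial1[OF e] and e2 = expands_as_partial2[OF e]
  have cont: "continuous (at (a, b)) (\<lambda>z. g (fst z) (snd z))" if "expands_as g a b c' R" for g c'
  proof -
    have "isCont (\<lambda>(x, y). g x y) (a, b)"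
      using expands_as_continuous[OF that] ab continuous_on_eq_continuous_at[OF open_box2] by blast
    then show ?thesis by (simp only: case_prod_unfold)
  qed
  note conts = cont[OF e1] cont[OF e2] cont[OF expands_as_partial1[OF e1]] cont[OF expands_as_partial2[OF e1]]
    cont[OF expands_as_partial2[OF e2]]
  have nhds: "(w \<longlongrightarrow> w p) (nhds p)" if "isCont w p" for w :: "real \<times> real \<Rightarrow> real" and p
    using that by (simp add: continuous_at tendsto_at_iff_tendsto_nhds)
  have "isCont ?W (a, b)" "isCont ?\<Delta> (a, b)"
    by (intro continuous_intros conts)+
  from this[THEN nhds]
  have "\<forall>\<^sub>F z in nhds (a, b). 0 < ?W z" "\<forall>\<^sub>F z in nhds (a, b). 0 < ?\<Delta> z"
    using W \<Delta> by (auto elim!: order_tendstoD(1))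
  moreover have "\<forall>\<^sub>F z in nhds (a, b). z \<in> box2 a b R"
    by (rule eventually_nhds_in_open[OF open_box2 ab])
  ultimately show ?thesis
  proof eventually_elim
    case (elim z)
    obtain u v where z: "z = (u, v)" by fastforce
    have uv: "(u, v) \<in> box2 a b R" using elim z by auto
    have W': "1 - (partial1 h u v)\<^sup>2 + (partial2 h u v)\<^sup>2 > 0" using elim z by simp
    let ?D = "partial1 (partial1 h) u v * partial2 (partial2 h) u v - (partial2 (partial1 h) u v)\<^sup>2"
    let ?K = "- ?D / (1 - (partial1 h u v)\<^sup>2 + (partial2 h u v)\<^sup>2)\<^sup>2"
    have "0 < \<sigma> * ?D" using elim z by simp
    then have "0 < \<sigma> * ?D / (1 - (partial1 h u v)\<^sup>2 + (partial2 h u v)\<^sup>2)\<^sup>2"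
      using W' by (intro divide_pos_pos zero_less_power)
    moreover have "\<sigma> * (- D / w) = - (\<sigma> * D / w)" for D w :: real by simp
    ultimately have "\<sigma> * ?K < 0" by (simp only: neg_less_0_iff_less)
    moreover have "real_analytic_on h {(u, v)}"
      using expands_as_real_analytic[OF e] uv unfolding real_analytic_on_def by blast
    ultimately show ?case
      using expands_as_lorentz_graph[OF e uv W'] uv unfolding z by blast
  qed
qed

lemma eventually_nhds_imp_open_superset:
  assumes "\<And>p. p \<in> L \<Longrightarrow> \<forall>\<^sub>F q in nhds p. P q"
  shows "\<exists>U. open U \<and> L \<subseteq> U \<and> (\<forall>q\<in>U. P q)"
proof (intro exI conjI)
  show "L \<subseteq> interior {q. P q}"
    using assms by (fastforce simp: eventually_nhds intro: interiorI)
  show "\<forall>q\<in>interior {q. P q}. P q" using interior_subset by blast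
qed auto

section \<open>The rotated graphs near the axis\<close>

text \<open>On the axis evenness forces \<open>f\<^sub>y = f\<^sub>x\<^sub>y = 0\<close>, so the minimal surface equation reduces to
  \<open>f\<^sub>x\<^sub>x = - (1 + f\<^sub>x\<^sup>2) f\<^sub>y\<^sub>y\<close> and the point is umbilic exactly if \<open>f\<^sub>y\<^sub>y = 0\<close>. Rotation changes the sign of
  \<open>f\<^sub>y\<^sub>y\<close>, which turns the Hessian determinant into \<open>(1 + f\<^sub>x\<^sup>2) f\<^sub>y\<^sub>y\<^sup>2 > 0\<close>; hence \<open>K < 0\<close>. Moreover
  \<open>h\<^sub>t = 0\<close> on the axis, so the graph is timelike there.\<close>

lemma wick_rotation_even:
  assumes D: "open D" and f: "real_analytic_on f D"
    and min: "\<And>x y. (x, y) \<in> D \<Longrightarrow> minimal_surface_eq f x y"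
    and umb: "\<not> umbilic_at inner (graph_surface f) a 0" and a: "(a, 0) \<in> D"
    and even: "\<And>x y. (x, y) \<in> D \<Longrightarrow> f x (- y) = f x y"
  defines "h \<equiv> \<lambda>t x. Re (taylor_subst f x (\<i> * complex_of_real t))"
  shows "\<forall>\<^sub>F (t, x) in nhds (0, a). (x, 0) \<in> D \<and> real_analytic_on h {(t, x)} \<and>
    summable (taylor_term f x (\<i> * complex_of_real t)) \<and>
    complex_of_real (h t x) = taylor_subst f x (\<i> * complex_of_real t) \<and>
    timelike_at (graph_surface h) t x \<and>
    (\<exists>K<0. has_gauss_curvature lorentz (graph_surface h) t x K) \<and> born_infeld_eq h t x"
proof -
  obtain c0 R where e0: "expands_as f a 0 c0 R" and sub: "box2 a 0 R \<subseteq> D"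
    using real_analytic_expands_as[OF f D a] .
  obtain c where e: "expands_as f a 0 c R" and par: "\<And>m n. (-1) ^ n \<noteq> (1::real) \<Longrightarrow> c m n = 0"
    by (rule expands_as_symmetric[OF e0, of 1]) (use even sub in auto)
  obtain d where rot: "rotated_coeff 1 c d"
  proof (rule rotated_coeff_exists[of c 1])
    fix m n assume "c m n \<noteq> 0"
    then have "even n" using par[of n m] by (cases "even n") auto
    then obtain k where "n = 2 * k" by (rule evenE)
    then show "1 * \<i> ^ n \<in> \<real>" by (simp add: power_mult)
  qed
  define g where "g = (\<lambda>x y. Re (1 * taylor_subst f x (\<i> * complex_of_real y)))"
  note G = wick_rotation_expansion[OF e rot norm_one, folded g_def]
  have hg: "h = (\<lambda>t x. g x t)" by (simp add: h_def g_def)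
  have eh: "expands_as h 0 a (transpose_coeff d) R"
    unfolding hg by (rule expands_as_flip[OF G(1)])
  have p: "partial1 h t x = partial2 g x t" "partial2 h t x = partial1 g x t"
    "partial1 (partial1 h) t x = partial2 (partial2 g) x t"
    "partial2 (partial2 h) t x = partial1 (partial1 g) x t"
    "partial2 (partial1 h) t x = partial1 (partial2 g) x t" for t x
    by (simp_all add: hg partial1_def partial2_def)
  have box: "\<bar>a - a\<bar> < R" "\<bar>0 - 0\<bar> < R" using expands_asD(1)[OF e] by auto
  have odd0: "c 0 (Suc 0) = 0" "c (Suc 0) (Suc 0) = 0" using par[of "Suc 0"] by auto
  have "complex_of_real (d m n) = \<i> ^ n * complex_of_real (c m n)" for m n
    using rot by (simp add: rotated_coeff_def)
  from this[of 0 "Suc 0"] this[of "Suc 0" 0] this[of "Suc 0" "Suc 0"] this[of 2 0] this[of 0 2]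
  have d: "d 0 (Suc 0) = 0" "d (Suc 0) (Suc 0) = 0" "d (Suc 0) 0 = c (Suc 0) 0" "d 2 0 = c 2 0" "d 0 2 = - c 0 2"
    by (simp_all add: odd0 flip: of_real_minus)
  note cf = expands_as_center_partials[OF e] and cg = expands_as_center_partials[OF G(1)]
  have "2 * c 2 0 + (1 + (c (Suc 0) 0)\<^sup>2) * (2 * c 0 2) = 0"
    using min[OF a] by (simp add: minimal_surface_eq_def cf odd0)
  then have c20: "c 2 0 = - (1 + (c (Suc 0) 0)\<^sup>2) * c 0 2" by (simp add: algebra_simps)
  have "c 0 2 \<noteq> 0"
    using umb expands_as_umbilic[OF e] by (auto simp: cf odd0 c20)
  moreover have "1 + (c (Suc 0) 0)\<^sup>2 > 0" by (simp add: add_pos_nonneg)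
  ultimately have "0 < 4 * ((1 + (c (Suc 0) 0)\<^sup>2) * (c 0 2)\<^sup>2)" by simp
  also have "\<dots> = 1 * (2 * d 0 2 * (2 * d 2 0) - (d (Suc 0) (Suc 0))\<^sup>2)" by (simp add: d c20 power2_eq_square algebra_simps)
  finally have "0 < 1 * (partial1 (partial1 h) 0 a * partial2 (partial2 h) 0 a - (partial2 (partial1 h) 0 a)\<^sup>2)"
    by (simp add: p cg expands_as_mixed[OF G(1) box])
  moreover have "1 - (partial1 h 0 a)\<^sup>2 + (partial2 h 0 a)\<^sup>2 > 0"
    by (simp add: p cg d add_pos_nonneg)
  ultimately have "\<forall>\<^sub>F (t, x) in nhds (0, a). (t, x) \<in> box2 0 a R \<and> real_analytic_on h {(t, x)} \<and>
    timelike_at (graph_surface h) t x \<and>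
    (\<exists>K. 1 * K < 0 \<and> has_gauss_curvature lorentz (graph_surface h) t x K)"
    using expands_as_lorentz_graph_eventually[OF eh] by blast
  then show ?thesis
  proof eventually_elim
    case (elim z)
    obtain t x where z: "z = (t, x)" by fastforce
    have xt: "(x, t) \<in> box2 a 0 R" using elim z by auto
    have "(1 - (partial2 g x t)\<^sup>2) * partial1 (partial1 g) x t
       + 2 * partial1 g x t * partial2 g x t * partial2 (partial1 g) x t
       - (1 + (partial1 g x t)\<^sup>2) * partial2 (partial2 g) x t = 0"
      by (rule wick_rotation_pde[OF e G(1) rot _ xt]) (use min sub in auto)
    then have "born_infeld_eq h t x"
      using expands_as_mixed[OF G(1), of x t] xt by (simp add: born_infeld_eq_def p mult_ac)
    moreover have "(x, 0) \<in> D" using sub xt expands_asD(1)[OF e] by auto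
    moreover have "complex_of_real (h t x) = taylor_subst f x (\<i> * complex_of_real t)"
      using G(3)[OF xt] by (simp add: hg g_def)
    ultimately show ?case using elim G(2)[OF xt] z by auto
  qed
qed

text \<open>On the axis oddness forces \<open>f\<^sub>x = f\<^sub>x\<^sub>x = f\<^sub>y\<^sub>y = 0\<close>, so the point is umbilic exactly if
  \<open>f\<^sub>x\<^sub>y = 0\<close>. The factor \<open>- \<i>\<close> cancels the \<open>\<i>\<close> from the single derivative in \<open>y\<close>, so that
  \<open>h\<^sub>t\<^sub>x = f\<^sub>x\<^sub>y\<close>. The Hessian determinant is \<open>- f\<^sub>x\<^sub>y\<^sup>2 < 0\<close>; hence \<open>K > 0\<close>.\<close>

lemma wick_rotation_odd:
  assumes D: "open D" and f: "real_analytic_on f D"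
    and min: "\<And>x y. (x, y) \<in> D \<Longrightarrow> minimal_surface_eq f x y"
    and umb: "\<not> umbilic_at inner (graph_surface f) a 0" and a: "(a, 0) \<in> D"
    and odd: "\<And>x y. (x, y) \<in> D \<Longrightarrow> f x (- y) = - f x y"
  defines "h \<equiv> \<lambda>t x. Re (- \<i> * taylor_subst f t (\<i> * complex_of_real x))"
  shows "\<forall>\<^sub>F (t, x) in nhds (a, 0). (t, 0) \<in> D \<and> real_analytic_on h {(t, x)} \<and>
    summable (taylor_term f t (\<i> * complex_of_real x)) \<and>
    complex_of_real (h t x) = - \<i> * taylor_subst f t (\<i> * complex_of_real x) \<and>
    timelike_at (graph_surface h) t x \<and>
    (\<exists>K>0. has_gauss_curvature lorentz (graph_surface h) t x K) \<and> born_infeld_eq h t x"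
proof -
  obtain c0 R where e0: "expands_as f a 0 c0 R" and sub: "box2 a 0 R \<subseteq> D"
    using real_analytic_expands_as[OF f D a] .
  obtain c where e: "expands_as f a 0 c R" and par: "\<And>m n. (-1) ^ n \<noteq> (-1::real) \<Longrightarrow> c m n = 0"
    by (rule expands_as_symmetric[OF e0, of "-1"]) (use odd sub in auto)
  obtain d where rot: "rotated_coeff (- \<i>) c d"
  proof (rule rotated_coeff_exists[of c "- \<i>"])
    fix m n assume "c m n \<noteq> 0"
    then have "odd n" using par[of n m] by (cases "even n") auto
    then obtain k where "n = 2 * k + 1" by (rule oddE)
    then show "- \<i> * \<i> ^ n \<in> \<real>" by (simp add: power_mult)
  qed
  have n: "norm (- \<i>) = 1" by simp
  have G: "expands_as h a 0 d R"
    "\<And>t x. (t, x) \<in> box2 a 0 R \<Longrightarrow> summable (taylor_term f t (\<i> * complex_of_real x))"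
    "\<And>t x. (t, x) \<in> box2 a 0 R \<Longrightarrow> complex_of_real (h t x) = - \<i> * taylor_subst f t (\<i> * complex_of_real x)"
    using wick_rotation_expansion[OF e rot n] unfolding h_def by blast+
  have even0: "c (Suc 0) 0 = 0" "c 2 0 = 0" "c 0 2 = 0" using par[of 0] par[of 2] by auto
  have "complex_of_real (d m n) = - \<i> * \<i> ^ n * complex_of_real (c m n)" for m n
    using rot by (simp add: rotated_coeff_def)
  from this[of "Suc 0" 0] this[of "Suc 0" "Suc 0"] this[of 2 0]
  have d: "d (Suc 0) 0 = 0" "d (Suc 0) (Suc 0) = c (Suc 0) (Suc 0)" "d 2 0 = 0"
    by (simp_all add: even0)
  note cf = expands_as_center_partials[OF e] and ch = expands_as_center_partials[OF G(1)]
  have "c (Suc 0) (Suc 0) \<noteq> 0"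
    using umb expands_as_umbilic[OF e] by (auto simp: cf even0)
  then have "0 < - 1 * (partial1 (partial1 h) a 0 * partial2 (partial2 h) a 0 - (partial2 (partial1 h) a 0)\<^sup>2)"
    by (simp add: ch d)
  moreover have "1 - (partial1 h a 0)\<^sup>2 + (partial2 h a 0)\<^sup>2 > 0"
    by (simp add: ch d add_pos_nonneg)
  ultimately have "\<forall>\<^sub>F (t, x) in nhds (a, 0). (t, x) \<in> box2 a 0 R \<and> real_analytic_on h {(t, x)} \<and>
    timelike_at (graph_surface h) t x \<and>
    (\<exists>K. - 1 * K < 0 \<and> has_gauss_curvature lorentz (graph_surface h) t x K)"
    using expands_as_lorentz_graph_eventually[OF G(1)] by blast
  then show ?thesis
  proof eventually_elim
    case (elim z)
    obtain t x where z: "z = (t, x)" by fastforce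
    have tx: "(t, x) \<in> box2 a 0 R" using elim z by auto
    have "(- 1 - (partial2 h t x)\<^sup>2) * partial1 (partial1 h) t x
       + 2 * partial1 h t x * partial2 h t x * partial2 (partial1 h) t x
       - (- 1 + (partial1 h t x)\<^sup>2) * partial2 (partial2 h) t x = 0"
      by (rule wick_rotation_pde[OF e G(1) rot _ tx]) (use min sub in auto)
    then have "born_infeld_eq h t x"
      by (simp add: born_infeld_eq_def algebra_simps)
    moreover have "(t, 0) \<in> D" using sub tx expands_asD(1)[OF e] by auto
    ultimately show ?case using elim G(2,3)[OF tx] z by auto
  qed
qed

text \<open>Both parts follow from the local statements: the set of points near which all assertions hold
  is open and contains the axis. Since the rotated function is defined by one formula everywhere,
  nothing has to be glued.\<close>

theorem theorem1:
  fixes f :: "real \<Rightarrow> real \<Rightarrow> real" and D :: "(real \<times> real) set"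
  assumes "open D" and "connected D"
    and "\<exists>x. (x, 0) \<in> D"
    and "\<And>x y. (x, y) \<in> D \<Longrightarrow> (x, - y) \<in> D"
    and "real_analytic_on f D"
    and "\<And>x y. (x, y) \<in> D \<Longrightarrow> minimal_surface_eq f x y"
    and "\<And>x. (x, 0) \<in> D \<Longrightarrow> \<not> umbilic_at inner (graph_surface f) x 0"
  shows "((\<forall>(x, y)\<in>D. f x (- y) = f x y) \<longrightarrow>
          (\<exists>U h. open U \<and> {(0, x) |x. (x, 0) \<in> D} \<subseteq> U \<and> U \<subseteq> {(t, x). (x, 0) \<in> D} \<and>
             real_analytic_on h U \<and>
             (\<forall>(t, x)\<in>U.
                summable (taylor_term f x (\<i> * complex_of_real t)) \<and>
                complex_of_real (h t x) = taylor_subst f x (\<i> * complex_of_real t) \<and>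
                timelike_at (graph_surface h) t x \<and>
                (\<exists>K<0. has_gauss_curvature lorentz (graph_surface h) t x K) \<and>
                born_infeld_eq h t x)))
       \<and> ((\<forall>(x, y)\<in>D. f x (- y) = - f x y) \<longrightarrow>
          (\<exists>U h. open U \<and> {(t, 0) |t. (t, 0) \<in> D} \<subseteq> U \<and> U \<subseteq> {(t, x). (t, 0) \<in> D} \<and>
             real_analytic_on h U \<and>
             (\<forall>(t, x)\<in>U.
                summable (taylor_term f t (\<i> * complex_of_real x)) \<and>
                complex_of_real (h t x) = - \<i> * taylor_subst f t (\<i> * complex_of_real x) \<and>
                timelike_at (graph_surface h) t x \<and>
                (\<exists>K>0. has_gauss_curvature lorentz (graph_surface h) t x K) \<and>
                born_infeld_eq h t x)))"
proof (intro conjI impI)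
  assume even: "\<forall>(x, y)\<in>D. f x (- y) = f x y"
  define h where "h = (\<lambda>t x. Re (taylor_subst f x (\<i> * complex_of_real t)))"
  define P where "P = (\<lambda>(t, x). (x, 0) \<in> D \<and> real_analytic_on h {(t, x)} \<and>
    summable (taylor_term f x (\<i> * complex_of_real t)) \<and>
    complex_of_real (h t x) = taylor_subst f x (\<i> * complex_of_real t) \<and>
    timelike_at (graph_surface h) t x \<and>
    (\<exists>K<0. has_gauss_curvature lorentz (graph_surface h) t x K) \<and> born_infeld_eq h t x)"
  have "\<forall>\<^sub>F q in nhds p. P q" if p: "p \<in> {(0, x) |x. (x, 0) \<in> D}" for p
  proof -
    obtain a where a: "p = (0, a)" "(a, 0) \<in> D" using p by blast
    show ?thesis
      unfolding P_def h_def a(1)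
      by (rule wick_rotation_even[OF assms(1,5,6) assms(7)[OF a(2)] a(2)]) (use even in auto)
  qed
  from eventually_nhds_imp_open_superset[OF this]
  obtain U where U: "open U" "{(0, x) |x. (x, 0) \<in> D} \<subseteq> U" "\<forall>q\<in>U. P q" by blast
  have "real_analytic_on h U" using U(3) unfolding P_def real_analytic_on_def by fast
  then show "\<exists>U h. open U \<and> {(0, x) |x. (x, 0) \<in> D} \<subseteq> U \<and> U \<subseteq> {(t, x). (x, 0) \<in> D} \<and>
             real_analytic_on h U \<and>
             (\<forall>(t, x)\<in>U.
                summable (taylor_term f x (\<i> * complex_of_real t)) \<and>
                complex_of_real (h t x) = taylor_subst f x (\<i> * complex_of_real t) \<and>
                timelike_at (graph_surface h) t x \<and>
                (\<exists>K<0. has_gauss_curvature lorentz (graph_surface h) t x K) \<and>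
                born_infeld_eq h t x)"
    using U by (intro exI[of _ U] exI[of _ h]) (auto simp: P_def)
next
  assume odd: "\<forall>(x, y)\<in>D. f x (- y) = - f x y"
  define h where "h = (\<lambda>t x. Re (- \<i> * taylor_subst f t (\<i> * complex_of_real x)))"
  define P where "P = (\<lambda>(t, x). (t, 0) \<in> D \<and> real_analytic_on h {(t, x)} \<and>
    summable (taylor_term f t (\<i> * complex_of_real x)) \<and>
    complex_of_real (h t x) = - \<i> * taylor_subst f t (\<i> * complex_of_real x) \<and>
    timelike_at (graph_surface h) t x \<and>
    (\<exists>K>0. has_gauss_curvature lorentz (graph_surface h) t x K) \<and> born_infeld_eq h t x)"
  have "\<forall>\<^sub>F q in nhds p. P q" if p: "p \<in> {(t, 0) |t. (t, 0) \<in> D}" for p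
  proof -
    obtain a where a: "p = (a, 0)" "(a, 0) \<in> D" using p by blast
    show ?thesis
      unfolding P_def h_def a(1)
      by (rule wick_rotation_odd[OF assms(1,5,6) assms(7)[OF a(2)] a(2)]) (use odd in auto)
  qed
  from eventually_nhds_imp_open_superset[OF this]
  obtain U where U: "open U" "{(t, 0) |t. (t, 0) \<in> D} \<subseteq> U" "\<forall>q\<in>U. P q" by blast
  have "real_analytic_on h U" using U(3) unfolding P_def real_analytic_on_def by fast
  then show "\<exists>U h. open U \<and> {(t, 0) |t. (t, 0) \<in> D} \<subseteq> U \<and> U \<subseteq> {(t, x). (t, 0) \<in> D} \<and>
             real_analytic_on h U \<and>
             (\<forall>(t, x)\<in>U.
                summable (taylor_term f t (\<i> * complex_of_real x)) \<and>
                complex_of_real (h t x) = - \<i> * taylor_subst f t (\<i> * complex_of_real x) \<and>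
                timelike_at (graph_surface h) t x \<and>
                (\<exists>K>0. has_gauss_curvature lorentz (graph_surface h) t x K) \<and>
                born_infeld_eq h t x)"
    using U by (intro exI[of _ U] exI[of _ h]) (auto simp: P_def)
qed

end
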